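(* Let $\Lambda_{(\phi,\psi)}=\begin{pmatrix} A & N\\ M & B\end{pmatrix}$ be a Morita ring which is an Artin algebra. Assume that the adjoint pair of functors $(M\otimes_A-,\mathrm{Hom}_B(M,-))$ induces an equivalence between $\mathrm{proj}\,A$ and $\mathrm{inj}\,B$, and that the adjoint pair of functors $(N\otimes_B-,\mathrm{Hom}_A(N,-))$ induces an equivalence between $\mathrm{proj}\,B$ and $\mathrm{inj}\,A$. Then the algebra $\Lambda_{(\phi,\psi)}$ is selfinjective.
   Context: $A,B$ are unital associative rings, $N$ is an $A$-$B$-bimodule, $M$ is a $B$-$A$-bimodule, $\phi:M\otimes_AN\to B$ is a $B$-$B$-bimodule homomorphism and $\psi:N\otimes_BM\to A$ is an $A$-$A$-bimodule homomorphism such that $\phi(m\otimes n)m'=m\psi(n\otimes m')$ and $n\phi(m\otimes n')=\psi(n\otimes m)n'$ for all $m,m'\in M$, $n,n'\in N$. The Morita ring $\Lambda_{(\phi,\psi)}$ is the set of matrices $\begin{pmatrix} a & n\\ m & b\end{pmatrix}$ with componentwise addition and multiplication $\begin{pmatrix} a & n\\ m & b\end{pmatrix}\begin{pmatrix} a' & n'\\ m' & b'\end{pmatrix}=\begin{pmatrix} aa'+\psi(n\otimes m') & an'+nb'\\ ma'+bm' & bb'+\phi(m\otimes n')\end{pmatrix}$. For an Artin algebra $\Gamma$, $\mathrm{proj}\,\Gamma$ (resp. $\mathrm{inj}\,\Gamma$) is the category of finitely generated projective (resp. injective) left $\Gamma$-modules. "An adjoint pair induces an equivalence" between two such subcategories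 means that the two functors restrict to mutually quasi-inverse equivalences between them, via the unit and counit of the adjunction. An Artin algebra is selfinjective if it is injective as a module over itself. *)

theory Defs
  imports "HOL-Algebra.Module" "HOL-Algebra.RingHom" "HOL-Algebra.Free_Abelian_Groups"
begin

section \<open>Modules and bimodules over noncommutative rings\<close>

text \<open>
  The record \<open>module\<close> of HOL-Algebra is reused, but its locale \<open>module\<close> requires a commutative
  base ring.  The fields \<open>mult\<close> and \<open>one\<close> that a module record inherits from rings play no role.
\<close>

locale left_module = R?: ring R + M?: abelian_group M
  for R :: "('r, 'x) ring_scheme" (structure) and M :: "('r, 'm, 'y) module_scheme" (structure) +
  assumes smult_closed:
      "\<lbrakk>r \<in> carrier R; x \<in> carrier M\<rbrakk> \<Longrightarrow> r \<odot>\<^bsub>M\<^esub> x \<in> carrier M"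
    and smult_l_distr:
      "\<lbrakk>r \<in> carrier R; s \<in> carrier R; x \<in> carrier M\<rbrakk>
        \<Longrightarrow> (r \<oplus>\<^bsub>R\<^esub> s) \<odot>\<^bsub>M\<^esub> x = r \<odot>\<^bsub>M\<^esub> x \<oplus>\<^bsub>M\<^esub> s \<odot>\<^bsub>M\<^esub> x"
    and smult_r_distr:
      "\<lbrakk>r \<in> carrier R; x \<in> carrier M; y \<in> carrier M\<rbrakk>
        \<Longrightarrow> r \<odot>\<^bsub>M\<^esub> (x \<oplus>\<^bsub>M\<^esub> y) = r \<odot>\<^bsub>M\<^esub> x \<oplus>\<^bsub>M\<^esub> r \<odot>\<^bsub>M\<^esub> y"
    and smult_assoc:
      "\<lbrakk>r \<in> carrier R; s \<in> carrier R; x \<in> carrier M\<rbrakk>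
        \<Longrightarrow> (r \<otimes>\<^bsub>R\<^esub> s) \<odot>\<^bsub>M\<^esub> x = r \<odot>\<^bsub>M\<^esub> (s \<odot>\<^bsub>M\<^esub> x)"
    and smult_one:
      "x \<in> carrier M \<Longrightarrow> \<one>\<^bsub>R\<^esub> \<odot>\<^bsub>M\<^esub> x = x"

record ('r, 's, 'm) bimodule = "('r, 'm) module" +
  rsmult :: "'m \<Rightarrow> 's \<Rightarrow> 'm" (infixl \<open>\<triangleleft>\<index>\<close> 70)

locale bimodule = left_module R M + S?: ring S
  for R :: "('r, 'x) ring_scheme" (structure) and S :: "('s, 'z) ring_scheme" (structure)
    and M :: "('r, 's, 'm, 'y) bimodule_scheme" (structure) +
  assumes rsmult_closed:
      "\<lbrakk>x \<in> carrier M; s \<in> carrier S\<rbrakk> \<Longrightarrow> x \<triangleleft>\<^bsub>M\<^esub> s \<in> carrier M"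
    and rsmult_r_distr:
      "\<lbrakk>x \<in> carrier M; s \<in> carrier S; t \<in> carrier S\<rbrakk>
        \<Longrightarrow> x \<triangleleft>\<^bsub>M\<^esub> (s \<oplus>\<^bsub>S\<^esub> t) = x \<triangleleft>\<^bsub>M\<^esub> s \<oplus>\<^bsub>M\<^esub> x \<triangleleft>\<^bsub>M\<^esub> t"
    and rsmult_l_distr:
      "\<lbrakk>x \<in> carrier M; y \<in> carrier M; s \<in> carrier S\<rbrakk>
        \<Longrightarrow> (x \<oplus>\<^bsub>M\<^esub> y) \<triangleleft>\<^bsub>M\<^esub> s = x \<triangleleft>\<^bsub>M\<^esub> s \<oplus>\<^bsub>M\<^esub> y \<triangleleft>\<^bsub>M\<^esub> s"
    and rsmult_assoc:
      "\<lbrakk>x \<in> carrier M; s \<in> carrier S; t \<in> carrier S\<rbrakk>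
        \<Longrightarrow> x \<triangleleft>\<^bsub>M\<^esub> (s \<otimes>\<^bsub>S\<^esub> t) = (x \<triangleleft>\<^bsub>M\<^esub> s) \<triangleleft>\<^bsub>M\<^esub> t"
    and rsmult_one:
      "x \<in> carrier M \<Longrightarrow> x \<triangleleft>\<^bsub>M\<^esub> \<one>\<^bsub>S\<^esub> = x"
    and smult_rsmult:
      "\<lbrakk>r \<in> carrier R; x \<in> carrier M; s \<in> carrier S\<rbrakk>
        \<Longrightarrow> (r \<odot>\<^bsub>M\<^esub> x) \<triangleleft>\<^bsub>M\<^esub> s = r \<odot>\<^bsub>M\<^esub> (x \<triangleleft>\<^bsub>M\<^esub> s)"

definition regular :: "('r, 'x) ring_scheme \<Rightarrow> ('r, 'r, 'r) bimodule" where
  "regular R = \<lparr>carrier = carrier R, monoid.mult = monoid.mult R, one = one R,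
     ring.zero = ring.zero R, add = add R, smult = monoid.mult R, rsmult = monoid.mult R\<rparr>"

definition module_hom ::
  "('r, 'x) ring_scheme \<Rightarrow> ('r, 'm, 'y) module_scheme \<Rightarrow> ('r, 'n, 'z) module_scheme \<Rightarrow> ('m \<Rightarrow> 'n) set"
  where
  "module_hom R X Y = {f \<in> carrier X \<rightarrow> carrier Y.
     (\<forall>x\<in>carrier X. \<forall>y\<in>carrier X. f (x \<oplus>\<^bsub>X\<^esub> y) = f x \<oplus>\<^bsub>Y\<^esub> f y) \<and>
     (\<forall>r\<in>carrier R. \<forall>x\<in>carrier X. f (r \<odot>\<^bsub>X\<^esub> x) = r \<odot>\<^bsub>Y\<^esub> f x)}"

definition module_iso ::
  "('r, 'x) ring_scheme \<Rightarrow> ('r, 'm, 'y) module_scheme \<Rightarrow> ('r, 'n, 'z) module_scheme \<Rightarrow> ('m \<Rightarrow> 'n) set"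
  where
  "module_iso R X Y = {f \<in> module_hom R X Y. bij_betw f (carrier X) (carrier Y)}"

definition bimodule_hom ::
  "('r, 'x) ring_scheme \<Rightarrow> ('s, 'w) ring_scheme \<Rightarrow> ('r, 's, 'm, 'y) bimodule_scheme
    \<Rightarrow> ('r, 's, 'n, 'z) bimodule_scheme \<Rightarrow> ('m \<Rightarrow> 'n) set"
  where
  "bimodule_hom R S X Y = {f \<in> module_hom R X Y.
     \<forall>x\<in>carrier X. \<forall>s\<in>carrier S. f (x \<triangleleft>\<^bsub>X\<^esub> s) = f x \<triangleleft>\<^bsub>Y\<^esub> s}"


section \<open>Finitely generated, projective and injective modules\<close>

definition finitely_generated :: "('r, 'x) ring_scheme \<Rightarrow> ('r, 'm, 'y) module_scheme \<Rightarrow> bool" where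
  "finitely_generated R X \<longleftrightarrow> (\<exists>G. finite G \<and> G \<subseteq> carrier X \<and>
     (\<forall>x\<in>carrier X. \<exists>c \<in> G \<rightarrow> carrier R. x = (\<Oplus>\<^bsub>X\<^esub>g\<in>G. c g \<odot>\<^bsub>X\<^esub> g)))"

text \<open>
  HOL cannot quantify over types inside a formula, so the test modules in the definitions of
  projectivity and injectivity have their carriers inside one type \<open>'u\<close>, the universe.  The module
  that is tested may live in another type.  As soon as the type \<open>(nat \<Rightarrow> 'r) set\<close>, with \<open>'r\<close> the type
  of the base ring, embeds into \<open>'u\<close>, every finitely generated module has an isomorphic copy in \<open>'u\<close>
  (as a set of cosets in a free module of finite rank), and the properties no longer depend on \<open>'u\<close>:
  for injectivity this is Baer's criterion, and for projectivity of a finitely generated module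
  it suffices to test a surjection from a free module of finite rank.
\<close>

definition projective_module ::
  "'u itself \<Rightarrow> ('r, 'x) ring_scheme \<Rightarrow> ('r, 'm, 'y) module_scheme \<Rightarrow> bool" where
  "projective_module U R P \<longleftrightarrow> left_module R P \<and>
     (\<forall>(X :: ('r, 'u) module) (Y :: ('r, 'u) module) p f.
        left_module R X \<and> left_module R Y \<and>
        p \<in> module_hom R X Y \<and> p ` carrier X = carrier Y \<and> f \<in> module_hom R P Y \<longrightarrow>
        (\<exists>g \<in> module_hom R P X. \<forall>x\<in>carrier P. p (g x) = f x))"

definition injective_module ::
  "'u itself \<Rightarrow> ('r, 'x) ring_scheme \<Rightarrow> ('r, 'm, 'y) module_scheme \<Rightarrow> bool" where
  "injective_module U R E \<longleftrightarrow> left_module R E \<and>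
     (\<forall>(X :: ('r, 'u) module) (Y :: ('r, 'u) module) i f.
        left_module R X \<and> left_module R Y \<and>
        i \<in> module_hom R X Y \<and> inj_on i (carrier X) \<and> f \<in> module_hom R X E \<longrightarrow>
        (\<exists>g \<in> module_hom R Y E. \<forall>x\<in>carrier X. g (i x) = f x))"

definition fg_projective ::
  "'u itself \<Rightarrow> ('r, 'x) ring_scheme \<Rightarrow> ('r, 'm, 'y) module_scheme \<Rightarrow> bool" where
  "fg_projective U R P \<longleftrightarrow> projective_module U R P \<and> finitely_generated R P"

definition fg_injective ::
  "'u itself \<Rightarrow> ('r, 'x) ring_scheme \<Rightarrow> ('r, 'm, 'y) module_scheme \<Rightarrow> bool" where
  "fg_injective U R E \<longleftrightarrow> injective_module U R E \<and> finitely_generated R E"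

definition selfinjective :: "'u itself \<Rightarrow> ('r, 'x) ring_scheme \<Rightarrow> bool" where
  "selfinjective U R \<longleftrightarrow> injective_module U R (regular R)"


section \<open>Tensor products\<close>

text \<open>
  The tensor product of a right \<open>S\<close>-module \<open>M\<close> and a left \<open>S\<close>-module \<open>N\<close> is the free abelian group on
  pairs modulo the subgroup generated by the usual relations.  Its elements are cosets of formal
  integer combinations of pairs.
\<close>

definition tensor_relations ::
  "('s, 'x) ring_scheme \<Rightarrow> ('r, 's, 'm, 'y) bimodule_scheme \<Rightarrow> ('s, 'n, 'z) module_scheme
    \<Rightarrow> ('m \<times> 'n \<Rightarrow>\<^sub>0 int) set"
  where
  "tensor_relations S M N =
     {frag_of (m \<oplus>\<^bsub>M\<^esub> m', n) - frag_of (m, n) - frag_of (m', n) | m m' n.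
        m \<in> carrier M \<and> m' \<in> carrier M \<and> n \<in> carrier N} \<union>
     {frag_of (m, n \<oplus>\<^bsub>N\<^esub> n') - frag_of (m, n) - frag_of (m, n') | m n n'.
        m \<in> carrier M \<and> n \<in> carrier N \<and> n' \<in> carrier N} \<union>
     {frag_of (m \<triangleleft>\<^bsub>M\<^esub> s, n) - frag_of (m, s \<odot>\<^bsub>N\<^esub> n) | m s n.
        m \<in> carrier M \<and> s \<in> carrier S \<and> n \<in> carrier N}"

definition tensor_subgroup ::
  "('s, 'x) ring_scheme \<Rightarrow> ('r, 's, 'm, 'y) bimodule_scheme \<Rightarrow> ('s, 'n, 'z) module_scheme
    \<Rightarrow> ('m \<times> 'n \<Rightarrow>\<^sub>0 int) set"
  where
  "tensor_subgroup S M N =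
     generate (free_Abelian_group (carrier M \<times> carrier N)) (tensor_relations S M N)"

definition tensor_quotient ::
  "('s, 'x) ring_scheme \<Rightarrow> ('r, 's, 'm, 'y) bimodule_scheme \<Rightarrow> ('s, 'n, 'z) module_scheme
    \<Rightarrow> ('m \<times> 'n \<Rightarrow>\<^sub>0 int) set monoid"
  where
  "tensor_quotient S M N =
     free_Abelian_group (carrier M \<times> carrier N) Mod tensor_subgroup S M N"

definition tensor_group ::
  "('s, 'x) ring_scheme \<Rightarrow> ('r, 's, 'm, 'y) bimodule_scheme \<Rightarrow> ('s, 'n, 'z) module_scheme
    \<Rightarrow> ('m \<times> 'n \<Rightarrow>\<^sub>0 int) set ring"
  where
  "tensor_group S M N = \<lparr>carrier = carrier (tensor_quotient S M N), monoid.mult = undefined,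
     one = undefined, ring.zero = one (tensor_quotient S M N), add = monoid.mult (tensor_quotient S M N)\<rparr>"

definition pure_tensor ::
  "('s, 'x) ring_scheme \<Rightarrow> ('r, 's, 'm, 'y) bimodule_scheme \<Rightarrow> ('s, 'n, 'z) module_scheme
    \<Rightarrow> 'm \<Rightarrow> 'n \<Rightarrow> ('m \<times> 'n \<Rightarrow>\<^sub>0 int) set"
  where
  "pure_tensor S M N m n =
     tensor_subgroup S M N #>\<^bsub>free_Abelian_group (carrier M \<times> carrier N)\<^esub> frag_of (m, n)"

text \<open>
  The additive map out of a tensor product that sends the pure tensor of \<open>m\<close> and \<open>n\<close> to \<open>\<beta> m n\<close>.
  For balanced biadditive \<open>\<beta>\<close>, all representatives of a coset have the same value, so the image
  below is a singleton.
\<close>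

definition tensor_lift ::
  "('c, 'x) ring_scheme \<Rightarrow> ('m \<Rightarrow> 'n \<Rightarrow> 'c) \<Rightarrow> ('m \<times> 'n \<Rightarrow>\<^sub>0 int) set \<Rightarrow> 'c" where
  "tensor_lift X \<beta> t = the_elem
     ((\<lambda>c. \<Oplus>\<^bsub>X\<^esub>k\<in>Poly_Mapping.keys c. [Poly_Mapping.lookup c k] \<cdot>\<^bsub>X\<^esub> \<beta> (fst k) (snd k)) ` t)"

definition tensor_module ::
  "('s, 'x) ring_scheme \<Rightarrow> ('r, 's, 'm, 'y) bimodule_scheme \<Rightarrow> ('s, 'n, 'z) module_scheme
    \<Rightarrow> ('r, ('m \<times> 'n \<Rightarrow>\<^sub>0 int) set) module"
  where
  "tensor_module S M N = (let T = tensor_group S M N in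
     \<lparr>carrier = carrier T, monoid.mult = monoid.mult T, one = one T, ring.zero = ring.zero T, add = add T,
      smult = \<lambda>r. tensor_lift T (\<lambda>m n. pure_tensor S M N (r \<odot>\<^bsub>M\<^esub> m) n)\<rparr>)"

definition tensor_bimodule ::
  "('s, 'x) ring_scheme \<Rightarrow> ('r, 's, 'm, 'y) bimodule_scheme \<Rightarrow> ('s, 't, 'n, 'z) bimodule_scheme
    \<Rightarrow> ('r, 't, ('m \<times> 'n \<Rightarrow>\<^sub>0 int) set) bimodule"
  where
  "tensor_bimodule S M N = (let T = tensor_group S M N in
     \<lparr>carrier = carrier T, monoid.mult = monoid.mult T, one = one T, ring.zero = ring.zero T, add = add T,
      smult = \<lambda>r. tensor_lift T (\<lambda>m n. pure_tensor S M N (r \<odot>\<^bsub>M\<^esub> m) n),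
      rsmult = \<lambda>x t. tensor_lift T (\<lambda>m n. pure_tensor S M N m (n \<triangleleft>\<^bsub>N\<^esub> t)) x\<rparr>)"


section \<open>The tensor-Hom adjunction of a bimodule\<close>

text \<open>
  For an \<open>R\<close>-\<open>S\<close>-bimodule \<open>M\<close> and a left \<open>R\<close>-module \<open>I\<close>, the left \<open>S\<close>-module of \<open>R\<close>-linear maps
  from \<open>M\<close> to \<open>I\<close>, with \<open>(s f) m = f (m s)\<close>.  Maps are taken extensional, so that equality of maps
  is equality on the carrier of \<open>M\<close>.
\<close>

definition hom_module ::
  "('r, 'x) ring_scheme \<Rightarrow> ('r, 's, 'm, 'y) bimodule_scheme \<Rightarrow> ('r, 'i, 'z) module_scheme
    \<Rightarrow> ('s, 'm \<Rightarrow> 'i) module"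
  where
  "hom_module R M I =
     \<lparr>carrier = module_hom R M I \<inter> extensional (carrier M), monoid.mult = undefined, one = undefined,
      ring.zero = (\<lambda>m\<in>carrier M. \<zero>\<^bsub>I\<^esub>),
      add = (\<lambda>f g. \<lambda>m\<in>carrier M. f m \<oplus>\<^bsub>I\<^esub> g m),
      smult = (\<lambda>s f. \<lambda>m\<in>carrier M. f (m \<triangleleft>\<^bsub>M\<^esub> s))\<rparr>"

definition adj_unit ::
  "('s, 'x) ring_scheme \<Rightarrow> ('r, 's, 'm, 'y) bimodule_scheme \<Rightarrow> ('s, 'p, 'z) module_scheme
    \<Rightarrow> 'p \<Rightarrow> 'm \<Rightarrow> ('m \<times> 'p \<Rightarrow>\<^sub>0 int) set"
  where
  "adj_unit S M P p = (\<lambda>m\<in>carrier M. pure_tensor S M P m p)"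

definition adj_counit ::
  "('r, 'i, 'z) module_scheme \<Rightarrow> ('m \<times> ('m \<Rightarrow> 'i) \<Rightarrow>\<^sub>0 int) set \<Rightarrow> 'i" where
  "adj_counit I = tensor_lift I (\<lambda>m f. f m)"

text \<open>
  The adjoint pair of functors given by tensoring with \<open>M\<close> over \<open>S\<close> and by \<open>R\<close>-linear maps out of \<open>M\<close>
  induces an equivalence between proj \<open>S\<close> and inj \<open>R\<close>.  Both are full subcategories, so the functors
  restrict to them as soon as they do so on objects, and the restrictions are quasi-inverse via
  unit and counit (which are always natural) iff all components there are isomorphisms.
\<close>

definition adjoint_pair_induces_equivalence ::
  "'u itself \<Rightarrow> ('s, 'x) ring_scheme \<Rightarrow> ('r, 'w) ring_scheme
    \<Rightarrow> ('r, 's, 'm, 'y) bimodule_scheme \<Rightarrow> bool"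
  where
  "adjoint_pair_induces_equivalence U S R M \<longleftrightarrow>
     (\<forall>P :: ('s, 'u) module. fg_projective U S P \<longrightarrow>
        fg_injective U R (tensor_module S M P) \<and>
        adj_unit S M P \<in> module_iso S P (hom_module R M (tensor_module S M P))) \<and>
     (\<forall>I :: ('r, 'u) module. fg_injective U R I \<longrightarrow>
        fg_projective U S (hom_module R M I) \<and>
        adj_counit I \<in> module_iso R (tensor_module S M (hom_module R M I)) I)"


section \<open>Morita rings and Artin algebras\<close>

locale morita_data = A?: ring A + B?: ring B + N?: bimodule A B N + M?: bimodule B A M
  for A :: "'a ring" and B :: "'b ring"
    and N :: "('a, 'b, 'n) bimodule" and M :: "('b, 'a, 'm) bimodule"
    and \<phi> :: "('m \<times> 'n \<Rightarrow>\<^sub>0 int) set \<Rightarrow> 'b" and \<psi> :: "('n \<times> 'm \<Rightarrow>\<^sub>0 int) set \<Rightarrow> 'a" +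
  assumes phi_hom: "\<phi> \<in> bimodule_hom B B (tensor_bimodule A M N) (regular B)"
    and psi_hom: "\<psi> \<in> bimodule_hom A A (tensor_bimodule B N M) (regular A)"
    and phi_psi: "\<lbrakk>m \<in> carrier M; m' \<in> carrier M; n \<in> carrier N\<rbrakk>
      \<Longrightarrow> \<phi> (pure_tensor A M N m n) \<odot>\<^bsub>M\<^esub> m' = m \<triangleleft>\<^bsub>M\<^esub> \<psi> (pure_tensor B N M n m')"
    and psi_phi: "\<lbrakk>m \<in> carrier M; n \<in> carrier N; n' \<in> carrier N\<rbrakk>
      \<Longrightarrow> n \<triangleleft>\<^bsub>N\<^esub> \<phi> (pure_tensor A M N m n') = \<psi> (pure_tensor B N M n m) \<odot>\<^bsub>N\<^esub> n'"

text \<open>The quadruple \<open>(a, n, m, b)\<close> stands for the matrix with rows \<open>a, n\<close> and \<open>m, b\<close>.\<close>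

definition morita_ring ::
  "'a ring \<Rightarrow> 'b ring \<Rightarrow> ('a, 'b, 'n) bimodule \<Rightarrow> ('b, 'a, 'm) bimodule
    \<Rightarrow> (('m \<times> 'n \<Rightarrow>\<^sub>0 int) set \<Rightarrow> 'b) \<Rightarrow> (('n \<times> 'm \<Rightarrow>\<^sub>0 int) set \<Rightarrow> 'a)
    \<Rightarrow> ('a \<times> 'n \<times> 'm \<times> 'b) ring"
  where
  "morita_ring A B N M \<phi> \<psi> =
     \<lparr>carrier = carrier A \<times> carrier N \<times> carrier M \<times> carrier B,
      monoid.mult = (\<lambda>(a, n, m, b) (a', n', m', b').
        (a \<otimes>\<^bsub>A\<^esub> a' \<oplus>\<^bsub>A\<^esub> \<psi> (pure_tensor B N M n m'),
         a \<odot>\<^bsub>N\<^esub> n' \<oplus>\<^bsub>N\<^esub> n \<triangleleft>\<^bsub>N\<^esub> b',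
         m \<triangleleft>\<^bsub>M\<^esub> a' \<oplus>\<^bsub>M\<^esub> b \<odot>\<^bsub>M\<^esub> m',
         b \<otimes>\<^bsub>B\<^esub> b' \<oplus>\<^bsub>B\<^esub> \<phi> (pure_tensor A M N m n'))),
      one = (\<one>\<^bsub>A\<^esub>, \<zero>\<^bsub>N\<^esub>, \<zero>\<^bsub>M\<^esub>, \<one>\<^bsub>B\<^esub>),
      ring.zero = (\<zero>\<^bsub>A\<^esub>, \<zero>\<^bsub>N\<^esub>, \<zero>\<^bsub>M\<^esub>, \<zero>\<^bsub>B\<^esub>),
      add = (\<lambda>(a, n, m, b) (a', n', m', b').
        (a \<oplus>\<^bsub>A\<^esub> a', n \<oplus>\<^bsub>N\<^esub> n', m \<oplus>\<^bsub>M\<^esub> m', b \<oplus>\<^bsub>B\<^esub> b'))\<rparr>"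

locale commutative_artinian_ring = cring K for K :: "('k, 'x) ring_scheme" (structure) +
  assumes descending_chain:
    "\<lbrakk>\<And>i :: nat. ideal (J i) K; \<And>i. J (Suc i) \<subseteq> J i\<rbrakk> \<Longrightarrow> \<exists>i0. \<forall>i\<ge>i0. J i = J i0"

definition restrict_scalars ::
  "('k \<Rightarrow> 'r) \<Rightarrow> ('r, 'x) ring_scheme \<Rightarrow> ('k, 'r) module" where
  "restrict_scalars h R = \<lparr>carrier = carrier R, monoid.mult = monoid.mult R, one = one R, ring.zero = ring.zero R,
     add = add R, smult = (\<lambda>k x. h k \<otimes>\<^bsub>R\<^esub> x)\<rparr>"

text \<open>\<open>R\<close> is an Artin algebra over \<open>K\<close> with structure map \<open>h\<close>.\<close>

locale artin_algebra = K?: commutative_artinian_ring K + R?: ring R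
  for K :: "('k, 'x) ring_scheme" (structure) and h :: "'k \<Rightarrow> 'r"
    and R :: "('r, 'y) ring_scheme" (structure) +
  assumes structure_map: "h \<in> ring_hom K R"
    and central: "\<lbrakk>k \<in> carrier K; x \<in> carrier R\<rbrakk> \<Longrightarrow> h k \<otimes>\<^bsub>R\<^esub> x = x \<otimes>\<^bsub>R\<^esub> h k"
    and module_finite: "finitely_generated K (restrict_scalars h R)"

end

theory Submission
  imports Defs
begin

text \<open>
  Write \<open>\<Lambda>\<close> for the Morita ring.  As a left module over itself it is the direct sum of its two
  columns, the left ideals spanned by the diagonal idempotents, and it is enough to show that each
  column is injective.  Consider the first column, which has \<open>A\<close> above \<open>M\<close>.

  Evaluating the equivalence between proj \<open>A\<close> and inj \<open>B\<close> at the projective module \<open>A\<close> gives two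
  facts: \<open>M\<close>, being isomorphic to its tensor product with \<open>A\<close>, is an injective \<open>B\<close>-module, and the unit
  at \<open>A\<close> being bijective means that every \<open>B\<close>-linear endomorphism of \<open>M\<close> is right multiplication by
  a unique element of \<open>A\<close> (\<open>equivalence_imp_injective_and_endomorphisms\<close>).

  The second fact says that the column is coinduced from its lower entry \<open>M\<close>: if \<open>f\<close> is the idempotent
  of the corner \<open>B\<close>, the column is identified with the \<open>B\<close>-linear maps from \<open>f \<Lambda>\<close> to \<open>M\<close>.
  Coinduction is right adjoint to the functor \<open>X \<mapsto> f X\<close>, which preserves injective maps, and so it
  carries the injective \<open>B\<close>-module \<open>M\<close> to an injective \<open>\<Lambda>\<close>-module (\<open>coinduced_injective\<close>,
  \<open>column_injective\<close>).  This happens inside an arbitrary ring with a Peirce decomposition, where the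
  maps \<open>\<phi>\<close> and \<open>\<psi>\<close> are hidden in the multiplication.  The second column is treated in the same way
  with the pair \<open>B\<close>, \<open>N\<close> in place of \<open>A\<close>, \<open>M\<close>.

  Injectivity is assumed for test modules in one universe and claimed for test modules in another.
  Baer's criterion (\<open>injective_imp_baer\<close>, \<open>baer_imp_injective\<close>) bridges the gap: it refers only to
  left ideals, and these have copies in any universe that is large enough to contain the ring.
\<close>

section \<open>Modules and homomorphisms\<close>

lemma left_moduleI:
  assumes "ring R" "abelian_group M"
    and "\<And>r x. \<lbrakk>r \<in> carrier R; x \<in> carrier M\<rbrakk> \<Longrightarrow> r \<odot>\<^bsub>M\<^esub> x \<in> carrier M"
    and "\<And>r s x. \<lbrakk>r \<in> carrier R; s \<in> carrier R; x \<in> carrier M\<rbrakk>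
        \<Longrightarrow> (r \<oplus>\<^bsub>R\<^esub> s) \<odot>\<^bsub>M\<^esub> x = r \<odot>\<^bsub>M\<^esub> x \<oplus>\<^bsub>M\<^esub> s \<odot>\<^bsub>M\<^esub> x"
    and "\<And>r x y. \<lbrakk>r \<in> carrier R; x \<in> carrier M; y \<in> carrier M\<rbrakk>
        \<Longrightarrow> r \<odot>\<^bsub>M\<^esub> (x \<oplus>\<^bsub>M\<^esub> y) = r \<odot>\<^bsub>M\<^esub> x \<oplus>\<^bsub>M\<^esub> r \<odot>\<^bsub>M\<^esub> y"
    and "\<And>r s x. \<lbrakk>r \<in> carrier R; s \<in> carrier R; x \<in> carrier M\<rbrakk>
        \<Longrightarrow> (r \<otimes>\<^bsub>R\<^esub> s) \<odot>\<^bsub>M\<^esub> x = r \<odot>\<^bsub>M\<^esub> (s \<odot>\<^bsub>M\<^esub> x)"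
    and "\<And>x. x \<in> carrier M \<Longrightarrow> \<one>\<^bsub>R\<^esub> \<odot>\<^bsub>M\<^esub> x = x"
  shows "left_module R M"
  using assms by (simp add: left_module_def left_module_axioms_def)

context left_module
begin

lemma smult_zero_right:
  assumes "r \<in> carrier R" shows "r \<odot>\<^bsub>M\<^esub> \<zero>\<^bsub>M\<^esub> = \<zero>\<^bsub>M\<^esub>"
proof -
  have "r \<odot>\<^bsub>M\<^esub> \<zero>\<^bsub>M\<^esub> \<oplus>\<^bsub>M\<^esub> r \<odot>\<^bsub>M\<^esub> \<zero>\<^bsub>M\<^esub> = r \<odot>\<^bsub>M\<^esub> \<zero>\<^bsub>M\<^esub>"
    using assms by (simp flip: smult_r_distr)
  thus ?thesis
    using assms M.add.r_cancel_one smult_closed by blast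
qed

lemma smult_zero_left:
  assumes "x \<in> carrier M" shows "\<zero>\<^bsub>R\<^esub> \<odot>\<^bsub>M\<^esub> x = \<zero>\<^bsub>M\<^esub>"
proof -
  have "\<zero>\<^bsub>R\<^esub> \<odot>\<^bsub>M\<^esub> x \<oplus>\<^bsub>M\<^esub> \<zero>\<^bsub>R\<^esub> \<odot>\<^bsub>M\<^esub> x = \<zero>\<^bsub>R\<^esub> \<odot>\<^bsub>M\<^esub> x"
    using assms by (simp flip: smult_l_distr)
  thus ?thesis
    using assms M.add.r_cancel_one smult_closed by blast
qed

lemma smult_minus_one:
  assumes "x \<in> carrier M" shows "(\<ominus>\<^bsub>R\<^esub> \<one>\<^bsub>R\<^esub>) \<odot>\<^bsub>M\<^esub> x = \<ominus>\<^bsub>M\<^esub> x"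
proof -
  have "(\<ominus>\<^bsub>R\<^esub> \<one>\<^bsub>R\<^esub>) \<odot>\<^bsub>M\<^esub> x \<oplus>\<^bsub>M\<^esub> x = \<zero>\<^bsub>M\<^esub>"
    using assms smult_l_distr[of "\<ominus>\<^bsub>R\<^esub> \<one>\<^bsub>R\<^esub>" "\<one>\<^bsub>R\<^esub>" x]
    by (simp add: smult_one smult_zero_left R.l_neg)
  thus ?thesis
    using assms by (simp add: M.minus_equality smult_closed)
qed

lemma smult_a_inv:
  assumes "r \<in> carrier R" "x \<in> carrier M" shows "r \<odot>\<^bsub>M\<^esub> (\<ominus>\<^bsub>M\<^esub> x) = \<ominus>\<^bsub>M\<^esub> (r \<odot>\<^bsub>M\<^esub> x)"
proof -
  have "r \<odot>\<^bsub>M\<^esub> (\<ominus>\<^bsub>M\<^esub> x) \<oplus>\<^bsub>M\<^esub> r \<odot>\<^bsub>M\<^esub> x = \<zero>\<^bsub>M\<^esub>"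
    using assms smult_r_distr[of r "\<ominus>\<^bsub>M\<^esub> x" x] by (simp add: smult_zero_right M.l_neg)
  thus ?thesis
    using assms by (simp add: M.minus_equality smult_closed)
qed


text \<open>
  The scalar \<open>-1\<close> provides the negatives.
\<close>

lemma left_module_carrier_update:
  assumes J: "J \<subseteq> carrier M" "\<zero>\<^bsub>M\<^esub> \<in> J" "\<And>x y. \<lbrakk>x \<in> J; y \<in> J\<rbrakk> \<Longrightarrow> x \<oplus>\<^bsub>M\<^esub> y \<in> J"
    "\<And>r x. \<lbrakk>r \<in> carrier R; x \<in> J\<rbrakk> \<Longrightarrow> r \<odot>\<^bsub>M\<^esub> x \<in> J"
  shows "left_module R (M\<lparr>carrier := J\<rparr>)"
proof (rule left_moduleI)
  have "\<exists>y\<in>J. y \<oplus>\<^bsub>M\<^esub> x = \<zero>\<^bsub>M\<^esub>" if "x \<in> J" for x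
  proof
    show "\<ominus>\<^bsub>M\<^esub> x \<oplus>\<^bsub>M\<^esub> x = \<zero>\<^bsub>M\<^esub>"
      using that J(1) by (auto simp: M.l_neg)
    show "\<ominus>\<^bsub>M\<^esub> x \<in> J"
      using that J(1) J(4)[of "\<ominus>\<^bsub>R\<^esub> \<one>\<^bsub>R\<^esub>" x] smult_minus_one[of x] by auto
  qed
  then show "abelian_group (M\<lparr>carrier := J\<rparr>)"
    using J by (intro abelian_groupI) (auto simp: M.a_assoc M.a_comm M.a_lcomm subset_iff)
qed (use J in \<open>auto simp: subset_iff smult_l_distr smult_r_distr smult_assoc smult_one R.ring_axioms\<close>)

end

lemma regular_simps [simp]:
  "carrier (regular R) = carrier R" "add (regular R) = add R" "ring.zero (regular R) = ring.zero R"
  "smult (regular R) = monoid.mult R" "rsmult (regular R) = monoid.mult R"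
  by (simp_all add: regular_def)

lemma (in ring) left_module_regular: "left_module R (regular R)"
proof (rule left_moduleI)
  have "\<exists>y\<in>carrier R. y \<oplus> x = \<zero>" if "x \<in> carrier R" for x
    using that l_neg by blast
  then show "abelian_group (regular R)"
    by (intro abelian_groupI) (auto simp: a_assoc a_comm a_lcomm)
qed (auto simp: l_distr r_distr m_assoc ring_axioms)

lemma module_homI:
  assumes "\<And>x. x \<in> carrier X \<Longrightarrow> f x \<in> carrier Y"
    and "\<And>x y. \<lbrakk>x \<in> carrier X; y \<in> carrier X\<rbrakk> \<Longrightarrow> f (x \<oplus>\<^bsub>X\<^esub> y) = f x \<oplus>\<^bsub>Y\<^esub> f y"
    and "\<And>r x. \<lbrakk>r \<in> carrier R; x \<in> carrier X\<rbrakk> \<Longrightarrow> f (r \<odot>\<^bsub>X\<^esub> x) = r \<odot>\<^bsub>Y\<^esub> f x"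
  shows "f \<in> module_hom R X Y"
  using assms by (auto simp: module_hom_def)

lemma module_homD:
  assumes "f \<in> module_hom R X Y"
  shows module_hom_closed: "x \<in> carrier X \<Longrightarrow> f x \<in> carrier Y"
    and module_hom_add: "\<lbrakk>x \<in> carrier X; y \<in> carrier X\<rbrakk> \<Longrightarrow> f (x \<oplus>\<^bsub>X\<^esub> y) = f x \<oplus>\<^bsub>Y\<^esub> f y"
    and module_hom_smult: "\<lbrakk>r \<in> carrier R; x \<in> carrier X\<rbrakk> \<Longrightarrow> f (r \<odot>\<^bsub>X\<^esub> x) = r \<odot>\<^bsub>Y\<^esub> f x"
  using assms by (auto simp: module_hom_def)

lemma module_hom_comp:
  assumes "f \<in> module_hom R X Y" "g \<in> module_hom R Y Z"
  shows "(\<lambda>x. g (f x)) \<in> module_hom R X Z"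
  using assms by (auto simp: module_hom_def Pi_iff)

lemma module_hom_zero:
  assumes "f \<in> module_hom R X Y" "left_module R X" "left_module R Y"
  shows "f \<zero>\<^bsub>X\<^esub> = \<zero>\<^bsub>Y\<^esub>"
proof -
  interpret X: left_module R X by fact
  interpret Y: left_module R Y by fact
  have "f (\<zero>\<^bsub>R\<^esub> \<odot>\<^bsub>X\<^esub> \<zero>\<^bsub>X\<^esub>) = \<zero>\<^bsub>R\<^esub> \<odot>\<^bsub>Y\<^esub> f \<zero>\<^bsub>X\<^esub>"
    using assms(1) by (simp add: module_hom_smult)
  thus ?thesis
    using assms(1) by (simp add: X.smult_zero_left Y.smult_zero_left module_hom_closed)
qed

lemma module_isoD:
  assumes "f \<in> module_iso R X Y"
  shows "f \<in> module_hom R X Y" "bij_betw f (carrier X) (carrier Y)"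
  using assms by (auto simp: module_iso_def)

lemma module_iso_inv:
  assumes f: "f \<in> module_iso R X Y" and X: "left_module R X"
  shows "inv_into (carrier X) f \<in> module_hom R Y X"
proof -
  interpret X: left_module R X by fact
  have hom: "f \<in> module_hom R X Y" and inj: "inj_on f (carrier X)" and img: "f ` carrier X = carrier Y"
    using module_isoD[OF f] by (auto simp: bij_betw_def)
  have pre: "\<exists>x\<in>carrier X. y = f x" if "y \<in> carrier Y" for y
    using that img by blast
  show ?thesis
  proof (rule module_homI)
    fix y assume y: "y \<in> carrier Y"
    then obtain x where x: "x \<in> carrier X" "y = f x"
      using pre by blast
    show "inv_into (carrier X) f y \<in> carrier X"
      using x by (simp add: inv_into_f_f[OF inj])
    show "inv_into (carrier X) f (r \<odot>\<^bsub>Y\<^esub> y) = r \<odot>\<^bsub>X\<^esub> inv_into (carrier X) f y" if "r \<in> carrier R" for r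
      using x that by (simp add: inv_into_f_f[OF inj] X.smult_closed flip: module_hom_smult[OF hom])
    fix z assume "z \<in> carrier Y"
    then obtain x' where x': "x' \<in> carrier X" "z = f x'"
      using pre by blast
    show "inv_into (carrier X) f (y \<oplus>\<^bsub>Y\<^esub> z) = inv_into (carrier X) f y \<oplus>\<^bsub>X\<^esub> inv_into (carrier X) f z"
      using x x' by (simp add: inv_into_f_f[OF inj] flip: module_hom_add[OF hom])
  qed
qed

lemma injective_module_extend:
  fixes U :: "'u itself" and X Y :: "('r, 'u) module"
  assumes "injective_module U R E" "left_module R X" "left_module R Y"
    "i \<in> module_hom R X Y" "inj_on i (carrier X)" "f \<in> module_hom R X E"
  obtains g where "g \<in> module_hom R Y E" "\<And>x. x \<in> carrier X \<Longrightarrow> g (i x) = f x"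
proof -
  have "\<exists>g \<in> module_hom R Y E. \<forall>x\<in>carrier X. g (i x) = f x"
    using assms(1)[unfolded injective_module_def, THEN conjunct2, rule_format, of X Y i f] assms(2-6)
    by simp
  thus thesis
    using that by auto
qed

lemma injective_moduleI:
  fixes U :: "'u itself"
  assumes "left_module R E"
    and "\<And>(X :: ('r, 'u) module) (Y :: ('r, 'u) module) i f.
      \<lbrakk>left_module R X; left_module R Y; i \<in> module_hom R X Y; inj_on i (carrier X);
        f \<in> module_hom R X E\<rbrakk> \<Longrightarrow> \<exists>g \<in> module_hom R Y E. \<forall>x\<in>carrier X. g (i x) = f x"
  shows "injective_module U R E"
  using assms by (simp add: injective_module_def)

text \<open>
  A map into the retract \<open>D\<close> is extended as a map into \<open>E\<close> and then pushed back along the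
  retraction.  Besides transport along isomorphisms this covers direct summands.
\<close>

lemma injective_module_retract:
  fixes U :: "'u itself" and R :: "('r, 'x) ring_scheme"
  assumes E: "injective_module U R E" and D: "left_module R D"
    and j: "j \<in> module_hom R D E" and k: "k \<in> module_hom R E D"
    and kj: "\<And>d. d \<in> carrier D \<Longrightarrow> k (j d) = d"
  shows "injective_module U R D"
proof (rule injective_moduleI[OF D])
  fix X Y :: "('r, 'u) module" and i f
  assume *: "left_module R X" "left_module R Y" "i \<in> module_hom R X Y" "inj_on i (carrier X)"
    and f: "f \<in> module_hom R X D"
  obtain g where g: "g \<in> module_hom R Y E" "\<And>x. x \<in> carrier X \<Longrightarrow> g (i x) = j (f x)"
    by (rule injective_module_extend[OF E * module_hom_comp[OF f j]]) (rule that)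
  show "\<exists>g \<in> module_hom R Y D. \<forall>x\<in>carrier X. g (i x) = f x"
    using module_hom_comp[OF g(1) k] g(2) kj module_hom_closed[OF f] by (intro bexI[of _ "\<lambda>y. k (g y)"]) auto
qed

text \<open>
  Test modules have their carriers in a prescribed type.  A module living elsewhere takes part in
  the tests through its image under an injection into that type.
\<close>

definition copy_module :: "('m \<Rightarrow> 'u) \<Rightarrow> ('r, 'm, 'y) module_scheme \<Rightarrow> ('r, 'u) module" where
  "copy_module \<iota> X = \<lparr>carrier = \<iota> ` carrier X, monoid.mult = undefined, one = undefined,
     ring.zero = \<iota> \<zero>\<^bsub>X\<^esub>,
     add = (\<lambda>u v. \<iota> (inv_into (carrier X) \<iota> u \<oplus>\<^bsub>X\<^esub> inv_into (carrier X) \<iota> v)),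
     smult = (\<lambda>r u. \<iota> (r \<odot>\<^bsub>X\<^esub> inv_into (carrier X) \<iota> u))\<rparr>"

lemma copy_module:
  assumes "left_module R X" "inj_on \<iota> (carrier X)"
  shows left_module_copy: "left_module R (copy_module \<iota> X)"
    and copy_module_hom: "\<iota> \<in> module_hom R X (copy_module \<iota> X)"
    and copy_module_hom_inv: "inv_into (carrier X) \<iota> \<in> module_hom R (copy_module \<iota> X) X"
proof -
  interpret X: left_module R X by fact
  note [simp] = inv_into_f_f[OF assms(2)] X.smult_closed
  show "left_module R (copy_module \<iota> X)"
  proof (rule left_moduleI)
    have "\<exists>x\<in>carrier X. \<iota> (x \<oplus>\<^bsub>X\<^esub> y) = \<iota> \<zero>\<^bsub>X\<^esub>" if "y \<in> carrier X" for y
      using that by (metis X.M.a_inv_closed X.M.l_neg)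
    then show "abelian_group (copy_module \<iota> X)"
      by (intro abelian_groupI) (auto simp: copy_module_def X.M.a_assoc X.M.a_comm X.M.a_lcomm)
  qed (auto simp: copy_module_def X.smult_l_distr X.smult_r_distr X.smult_assoc X.smult_one X.R.ring_axioms)
  show "\<iota> \<in> module_hom R X (copy_module \<iota> X)"
    by (rule module_homI) (auto simp: copy_module_def)
  show "inv_into (carrier X) \<iota> \<in> module_hom R (copy_module \<iota> X) X"
    by (rule module_homI) (auto simp: copy_module_def)
qed

lemma carrier_copy_module: "carrier (copy_module \<iota> X) = \<iota> ` carrier X"
  by (simp add: copy_module_def)

section \<open>Baer's criterion\<close>

text \<open>
  A homomorphism from the ring to \<open>E\<close> is determined by its value \<open>c\<close> at \<open>1\<close>, so the last line
  says that \<open>\<phi>\<close> extends from the left ideal \<open>J\<close> to the whole ring.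
\<close>

definition baer_condition ::
  "('r, 'x) ring_scheme \<Rightarrow> ('r, 'm, 'y) module_scheme \<Rightarrow> bool" where
  "baer_condition R E \<longleftrightarrow> (\<forall>J \<phi>.
     J \<subseteq> carrier R \<and> left_module R ((regular R)\<lparr>carrier := J\<rparr>) \<and>
     \<phi> \<in> module_hom R ((regular R)\<lparr>carrier := J\<rparr>) E \<longrightarrow>
     (\<exists>c\<in>carrier E. \<forall>a\<in>J. \<phi> a = a \<odot>\<^bsub>E\<^esub> c))"

text \<open>
  A left ideal and the regular module both have copies in the universe of test modules as soon as
  the type of ring elements embeds there; extending along the inclusion of the copies gives \<open>c\<close> as
  the value at the copy of \<open>1\<close>.
\<close>

lemma injective_imp_baer:
  fixes R :: "('r, 'x) ring_scheme" and \<epsilon> :: "'r \<Rightarrow> 'u"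
  assumes E: "injective_module TYPE('u) R E" and \<epsilon>: "inj \<epsilon>"
  shows "baer_condition R E"
  unfolding baer_condition_def
proof (intro allI impI, elim conjE)
  fix J and \<phi>
  let ?J = "(regular R)\<lparr>carrier := J\<rparr>"
  assume J: "J \<subseteq> carrier R" and modJ: "left_module R ?J" and \<phi>: "\<phi> \<in> module_hom R ?J E"
  interpret E: left_module R E
    using E by (simp add: injective_module_def)
  have modR: "left_module R (regular R)"
    by (rule E.R.left_module_regular)
  have inj: "inj_on \<epsilon> (carrier ?J)" "inj_on \<epsilon> (carrier (regular R))"
    using \<epsilon> by (auto intro: inj_on_subset)
  let ?X = "copy_module \<epsilon> ?J" and ?Y = "copy_module \<epsilon> (regular R)"
  let ?\<nu> = "inv_into (carrier ?J) \<epsilon>"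
  have \<nu>: "?\<nu> \<in> module_hom R ?X ?J"
    by (rule copy_module_hom_inv[OF modJ inj(1)])
  have incl: "(\<lambda>a. a) \<in> module_hom R ?J (regular R)"
    using J by (auto intro!: module_homI)
  have i: "(\<lambda>u. \<epsilon> (?\<nu> u)) \<in> module_hom R ?X ?Y"
    by (rule module_hom_comp[OF module_hom_comp[OF \<nu> incl] copy_module_hom[OF modR inj(2)]])
  have inj_i: "inj_on (\<lambda>u. \<epsilon> (?\<nu> u)) (carrier ?X)"
    by (rule inj_onI) (auto simp: carrier_copy_module inj_on_eq_iff[OF inj(1)] f_inv_into_f)
  obtain g where g: "g \<in> module_hom R ?Y E"
    and gi: "\<And>x. x \<in> carrier ?X \<Longrightarrow> g (\<epsilon> (?\<nu> x)) = \<phi> (?\<nu> x)"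
    by (rule injective_module_extend[OF E left_module_copy[OF modJ inj(1)]
          left_module_copy[OF modR inj(2)] i inj_i module_hom_comp[OF \<nu> \<phi>]]) (rule that)
  let ?g = "\<lambda>a. g (\<epsilon> a)"
  have g': "?g \<in> module_hom R (regular R) E"
    by (rule module_hom_comp[OF copy_module_hom[OF modR inj(2)] g])
  have "\<phi> a = a \<odot>\<^bsub>E\<^esub> ?g \<one>\<^bsub>R\<^esub>" if a: "a \<in> J" for a
  proof -
    have "\<phi> a = ?g a"
      using gi[of "\<epsilon> a"] a inv_into_f_f[OF inj(1), of a] by (simp add: carrier_copy_module)
    also have "\<dots> = ?g (a \<odot>\<^bsub>regular R\<^esub> \<one>\<^bsub>R\<^esub>)"
      using a J by (simp add: subset_iff)
    also have "\<dots> = a \<odot>\<^bsub>E\<^esub> ?g \<one>\<^bsub>R\<^esub>"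
      by (rule module_hom_smult[OF g']) (use a J in auto)
    finally show ?thesis .
  qed
  moreover have "?g \<one>\<^bsub>R\<^esub> \<in> carrier E"
    using module_hom_closed[OF g', of "\<one>\<^bsub>R\<^esub>"] by simp
  ultimately show "\<exists>c\<in>carrier E. \<forall>a\<in>J. \<phi> a = a \<odot>\<^bsub>E\<^esub> c"
    by blast
qed

text \<open>
  Partial homomorphisms from \<open>Y\<close> to \<open>E\<close> are handled as graphs, because then upper bounds of chains
  are plain unions.  By linearity, the last clause suffices for the graph to be single-valued.
\<close>

definition linear_graph ::
  "('r, 'x) ring_scheme \<Rightarrow> ('r, 'm, 'y) module_scheme \<Rightarrow> ('r, 'e, 'z) module_scheme \<Rightarrow> ('m \<times> 'e) set \<Rightarrow> bool"
  where
  "linear_graph R Y E G \<longleftrightarrow>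
     G \<subseteq> carrier Y \<times> carrier E \<and> (\<zero>\<^bsub>Y\<^esub>, \<zero>\<^bsub>E\<^esub>) \<in> G \<and>
     (\<forall>y u y' u'. (y, u) \<in> G \<longrightarrow> (y', u') \<in> G \<longrightarrow> (y \<oplus>\<^bsub>Y\<^esub> y', u \<oplus>\<^bsub>E\<^esub> u') \<in> G) \<and>
     (\<forall>r\<in>carrier R. \<forall>y u. (y, u) \<in> G \<longrightarrow> (r \<odot>\<^bsub>Y\<^esub> y, r \<odot>\<^bsub>E\<^esub> u) \<in> G) \<and>
     (\<forall>u. (\<zero>\<^bsub>Y\<^esub>, u) \<in> G \<longrightarrow> u = \<zero>\<^bsub>E\<^esub>)"

locale two_modules = Y: left_module R Y + E: left_module R E
  for R :: "('r, 'x) ring_scheme" and Y :: "('r, 'm, 'y) module_scheme" and E :: "('r, 'e, 'z) module_scheme"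
begin

lemma linear_graphD:
  assumes "linear_graph R Y E G"
  shows "(y, u) \<in> G \<Longrightarrow> y \<in> carrier Y" "(y, u) \<in> G \<Longrightarrow> u \<in> carrier E"
    "(\<zero>\<^bsub>Y\<^esub>, \<zero>\<^bsub>E\<^esub>) \<in> G"
    "\<lbrakk>(y, u) \<in> G; (y', u') \<in> G\<rbrakk> \<Longrightarrow> (y \<oplus>\<^bsub>Y\<^esub> y', u \<oplus>\<^bsub>E\<^esub> u') \<in> G"
    "\<lbrakk>r \<in> carrier R; (y, u) \<in> G\<rbrakk> \<Longrightarrow> (r \<odot>\<^bsub>Y\<^esub> y, r \<odot>\<^bsub>E\<^esub> u) \<in> G"
    "(\<zero>\<^bsub>Y\<^esub>, u) \<in> G \<Longrightarrow> u = \<zero>\<^bsub>E\<^esub>"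
  using assms unfolding linear_graph_def by blast+

lemma linear_graph_minus:
  assumes "linear_graph R Y E G" "(y, u) \<in> G"
  shows "(\<ominus>\<^bsub>Y\<^esub> y, \<ominus>\<^bsub>E\<^esub> u) \<in> G"
  using linear_graphD(5)[OF assms(1) _ assms(2), of "\<ominus>\<^bsub>R\<^esub> \<one>\<^bsub>R\<^esub>"] linear_graphD(1,2)[OF assms]
  by (simp add: Y.smult_minus_one E.smult_minus_one)

lemma linear_graph_functional:
  assumes G: "linear_graph R Y E G" and u: "(y, u) \<in> G" and v: "(y, v) \<in> G"
  shows "u = v"
proof -
  note cl = linear_graphD(1,2)[OF G u] linear_graphD(2)[OF G v]
  have "(y \<oplus>\<^bsub>Y\<^esub> \<ominus>\<^bsub>Y\<^esub> y, u \<oplus>\<^bsub>E\<^esub> \<ominus>\<^bsub>E\<^esub> v) \<in> G"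
    by (rule linear_graphD(4)[OF G u linear_graph_minus[OF G v]])
  hence "u \<oplus>\<^bsub>E\<^esub> \<ominus>\<^bsub>E\<^esub> v = \<zero>\<^bsub>E\<^esub>"
    using cl linear_graphD(6)[OF G] by (simp add: Y.M.r_neg)
  thus ?thesis
    using cl E.M.minus_equality[of u "\<ominus>\<^bsub>E\<^esub> v"] by simp
qed

lemma linear_graph_Union:
  assumes "C \<noteq> {}" "subset.chain {G. linear_graph R Y E G} C"
  shows "linear_graph R Y E (\<Union>C)"
proof -
  have lin: "linear_graph R Y E G" if "G \<in> C" for G
    using assms(2) that unfolding subset_chain_def by blast
  have tot: "G \<subseteq> H \<or> H \<subseteq> G" if "G \<in> C" "H \<in> C" for G H
    using assms(2) that unfolding subset_chain_def by blast
  have add: "(y \<oplus>\<^bsub>Y\<^esub> y', u \<oplus>\<^bsub>E\<^esub> u') \<in> \<Union>C"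
    if yu: "(y, u) \<in> \<Union>C" and yu': "(y', u') \<in> \<Union>C" for y u y' u'
  proof -
    obtain G H where GH: "G \<in> C" "(y, u) \<in> G" "H \<in> C" "(y', u') \<in> H"
      using yu yu' by blast
    then obtain L where L: "L \<in> C" "(y, u) \<in> L" "(y', u') \<in> L"
      using tot[OF GH(1,3)] by blast
    thus ?thesis
      using linear_graphD(4)[OF lin[OF L(1)] L(2,3)] by blast
  qed
  have mult: "(r \<odot>\<^bsub>Y\<^esub> y, r \<odot>\<^bsub>E\<^esub> u) \<in> \<Union>C" if "r \<in> carrier R" "(y, u) \<in> \<Union>C" for r y u
    using that linear_graphD(5)[OF lin] by blast
  have zero: "u = \<zero>\<^bsub>E\<^esub>" if "(\<zero>\<^bsub>Y\<^esub>, u) \<in> \<Union>C" for u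
    using that linear_graphD(6)[OF lin] by blast
  have "\<Union>C \<subseteq> carrier Y \<times> carrier E" "(\<zero>\<^bsub>Y\<^esub>, \<zero>\<^bsub>E\<^esub>) \<in> \<Union>C"
    using assms(1) linear_graphD(1-3)[OF lin] by auto
  thus ?thesis
    unfolding linear_graph_def by (intro conjI allI ballI impI add mult zero)
qed

text \<open>
  The heart of Baer's criterion.  The scalars that move \<open>y\<close> into the domain of \<open>G\<close> form a left
  ideal, on which \<open>r \<mapsto> G (r y)\<close> is linear.  Baer's condition turns this map into \<open>r \<mapsto> r c\<close>, and then
  \<open>c\<close> is a consistent value at \<open>y\<close>.
\<close>

lemma linear_graph_extend_at:
  assumes baer: "baer_condition R E" and G: "linear_graph R Y E G" and y: "y \<in> carrier Y"
  obtains G' u where "linear_graph R Y E G'" "G \<subseteq> G'" "(y, u) \<in> G'"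
proof -
  note GD = linear_graphD[OF G]
  define J where "J = {r \<in> carrier R. \<exists>u. (r \<odot>\<^bsub>Y\<^esub> y, u) \<in> G}"
  define \<phi> where "\<phi> r = (THE u. (r \<odot>\<^bsub>Y\<^esub> y, u) \<in> G)" for r
  have \<phi>: "\<phi> r = u" if "(r \<odot>\<^bsub>Y\<^esub> y, u) \<in> G" for r u
    unfolding \<phi>_def using that linear_graph_functional[OF G] by blast
  have J0: "(\<zero>\<^bsub>R\<^esub> \<odot>\<^bsub>Y\<^esub> y, \<zero>\<^bsub>E\<^esub>) \<in> G"
    using y GD(3) by (simp add: Y.smult_zero_left)
  have Jadd: "((r \<oplus>\<^bsub>R\<^esub> s) \<odot>\<^bsub>Y\<^esub> y, u \<oplus>\<^bsub>E\<^esub> v) \<in> G"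
    if "(r \<odot>\<^bsub>Y\<^esub> y, u) \<in> G" "(s \<odot>\<^bsub>Y\<^esub> y, v) \<in> G" "r \<in> carrier R" "s \<in> carrier R" for r s u v
    using GD(4)[OF that(1,2)] that y by (simp add: Y.smult_l_distr)
  have Jmult: "((s \<otimes>\<^bsub>R\<^esub> r) \<odot>\<^bsub>Y\<^esub> y, s \<odot>\<^bsub>E\<^esub> u) \<in> G"
    if "(r \<odot>\<^bsub>Y\<^esub> y, u) \<in> G" "r \<in> carrier R" "s \<in> carrier R" for r s u
    using GD(5)[OF that(3,1)] that y by (simp add: Y.smult_assoc)
  have JI: "r \<in> J" if "(r \<odot>\<^bsub>Y\<^esub> y, u) \<in> G" "r \<in> carrier R" for r u
    using that unfolding J_def by blast
  have JE: "\<exists>u. (r \<odot>\<^bsub>Y\<^esub> y, u) \<in> G" "r \<in> carrier R" if "r \<in> J" for r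
    using that unfolding J_def by blast+
  have Jsum: "r \<oplus>\<^bsub>R\<^esub> s \<in> J" if "r \<in> J" "s \<in> J" for r s
    using JE[OF that(1)] JE[OF that(2)] Jadd JI Y.R.a_closed by meson
  have Jprod: "s \<otimes>\<^bsub>R\<^esub> r \<in> J" if "r \<in> J" "s \<in> carrier R" for r s
    using JE[OF that(1)] Jmult JI Y.R.m_closed that(2) by meson
  have "left_module R ((regular R)\<lparr>carrier := J\<rparr>)"
    by (rule left_module.left_module_carrier_update[OF Y.R.left_module_regular])
       (use JI[OF J0] Jsum Jprod JE(2) in auto)
  moreover have "\<phi> \<in> module_hom R ((regular R)\<lparr>carrier := J\<rparr>) E"
    by (rule module_homI) (use GD(2) Jadd Jmult \<phi> in \<open>auto simp: J_def\<close>)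
  moreover have "J \<subseteq> carrier R"
    by (auto simp: J_def)
  ultimately obtain c where c: "c \<in> carrier E" "\<And>r. r \<in> J \<Longrightarrow> \<phi> r = r \<odot>\<^bsub>E\<^esub> c"
    using baer[unfolded baer_condition_def, rule_format, of J \<phi>] by auto
  have rc: "u = r \<odot>\<^bsub>E\<^esub> c" if "(r \<odot>\<^bsub>Y\<^esub> y, u) \<in> G" "r \<in> carrier R" for r u
    using \<phi>[OF that(1)] c(2)[of r] that by (auto simp: J_def)
  \<comment> \<open>The domain of \<open>G\<close> and \<open>R y\<close> may overlap; that both prescriptions agree there is the fact \<open>rc\<close>.\<close>
  define G' where "G' = {(d \<oplus>\<^bsub>Y\<^esub> r \<odot>\<^bsub>Y\<^esub> y, v \<oplus>\<^bsub>E\<^esub> r \<odot>\<^bsub>E\<^esub> c) | d v r. (d, v) \<in> G \<and> r \<in> carrier R}"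
  have G'I: "(d \<oplus>\<^bsub>Y\<^esub> r \<odot>\<^bsub>Y\<^esub> y, v \<oplus>\<^bsub>E\<^esub> r \<odot>\<^bsub>E\<^esub> c) \<in> G'" if "(d, v) \<in> G" "r \<in> carrier R" for d v r
    using that unfolding G'_def by blast
  have GG': "G \<subseteq> G'"
  proof
    fix p assume "p \<in> G"
    moreover obtain d v where "p = (d, v)" by fastforce
    ultimately show "p \<in> G'"
      using G'I[of d v "\<zero>\<^bsub>R\<^esub>"] y c(1) GD(1,2)[of d v]
      by (simp add: Y.smult_zero_left E.smult_zero_left)
  qed
  have add: "(z \<oplus>\<^bsub>Y\<^esub> z', u \<oplus>\<^bsub>E\<^esub> u') \<in> G'" if zu: "(z, u) \<in> G'" and zu': "(z', u') \<in> G'" for z u z' u'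
  proof -
    obtain d v r where 1: "z = d \<oplus>\<^bsub>Y\<^esub> r \<odot>\<^bsub>Y\<^esub> y" "u = v \<oplus>\<^bsub>E\<^esub> r \<odot>\<^bsub>E\<^esub> c" "(d, v) \<in> G" "r \<in> carrier R"
      using zu unfolding G'_def by blast
    obtain d' v' r' where 2: "z' = d' \<oplus>\<^bsub>Y\<^esub> r' \<odot>\<^bsub>Y\<^esub> y" "u' = v' \<oplus>\<^bsub>E\<^esub> r' \<odot>\<^bsub>E\<^esub> c" "(d', v') \<in> G" "r' \<in> carrier R"
      using zu' unfolding G'_def by blast
    have "z \<oplus>\<^bsub>Y\<^esub> z' = (d \<oplus>\<^bsub>Y\<^esub> d') \<oplus>\<^bsub>Y\<^esub> (r \<oplus>\<^bsub>R\<^esub> r') \<odot>\<^bsub>Y\<^esub> y"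
      using 1 2 y GD(1)[OF 1(3)] GD(1)[OF 2(3)]
      by (simp add: Y.smult_l_distr Y.smult_closed Y.M.a_assoc Y.M.a_lcomm)
    moreover have "u \<oplus>\<^bsub>E\<^esub> u' = (v \<oplus>\<^bsub>E\<^esub> v') \<oplus>\<^bsub>E\<^esub> (r \<oplus>\<^bsub>R\<^esub> r') \<odot>\<^bsub>E\<^esub> c"
      using 1 2 c GD(2)[OF 1(3)] GD(2)[OF 2(3)]
      by (simp add: E.smult_l_distr E.smult_closed E.M.a_assoc E.M.a_lcomm)
    ultimately show ?thesis
      using G'I[OF GD(4)[OF 1(3) 2(3)], of "r \<oplus>\<^bsub>R\<^esub> r'"] 1(4) 2(4) by simp
  qed
  have mult: "(s \<odot>\<^bsub>Y\<^esub> z, s \<odot>\<^bsub>E\<^esub> u) \<in> G'" if s: "s \<in> carrier R" and zu: "(z, u) \<in> G'" for s z u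
  proof -
    obtain d v r where 1: "z = d \<oplus>\<^bsub>Y\<^esub> r \<odot>\<^bsub>Y\<^esub> y" "u = v \<oplus>\<^bsub>E\<^esub> r \<odot>\<^bsub>E\<^esub> c" "(d, v) \<in> G" "r \<in> carrier R"
      using zu unfolding G'_def by blast
    have "s \<odot>\<^bsub>Y\<^esub> z = s \<odot>\<^bsub>Y\<^esub> d \<oplus>\<^bsub>Y\<^esub> (s \<otimes>\<^bsub>R\<^esub> r) \<odot>\<^bsub>Y\<^esub> y"
      using 1 y GD(1)[OF 1(3)] s by (simp add: Y.smult_r_distr Y.smult_closed Y.smult_assoc)
    moreover have "s \<odot>\<^bsub>E\<^esub> u = s \<odot>\<^bsub>E\<^esub> v \<oplus>\<^bsub>E\<^esub> (s \<otimes>\<^bsub>R\<^esub> r) \<odot>\<^bsub>E\<^esub> c"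
      using 1 c GD(2)[OF 1(3)] s by (simp add: E.smult_r_distr E.smult_closed E.smult_assoc)
    ultimately show ?thesis
      using G'I[OF GD(5)[OF s 1(3)], of "s \<otimes>\<^bsub>R\<^esub> r"] 1(4) s by simp
  qed
  have zero: "u = \<zero>\<^bsub>E\<^esub>" if "(\<zero>\<^bsub>Y\<^esub>, u) \<in> G'" for u
  proof -
    obtain d v r where 1: "\<zero>\<^bsub>Y\<^esub> = d \<oplus>\<^bsub>Y\<^esub> r \<odot>\<^bsub>Y\<^esub> y" "u = v \<oplus>\<^bsub>E\<^esub> r \<odot>\<^bsub>E\<^esub> c" "(d, v) \<in> G" "r \<in> carrier R"
      using \<open>(\<zero>\<^bsub>Y\<^esub>, u) \<in> G'\<close> unfolding G'_def by blast
    have "r \<odot>\<^bsub>Y\<^esub> y \<oplus>\<^bsub>Y\<^esub> d = \<zero>\<^bsub>Y\<^esub>"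
      using 1(1,4) y GD(1)[OF 1(3)] by (simp add: Y.smult_closed Y.M.a_comm)
    hence "\<ominus>\<^bsub>Y\<^esub> d = r \<odot>\<^bsub>Y\<^esub> y"
      using 1(4) y GD(1)[OF 1(3)] by (simp add: Y.smult_closed Y.M.minus_equality)
    hence "(r \<odot>\<^bsub>Y\<^esub> y, \<ominus>\<^bsub>E\<^esub> v) \<in> G"
      using linear_graph_minus[OF G 1(3)] by simp
    hence "\<ominus>\<^bsub>E\<^esub> v = r \<odot>\<^bsub>E\<^esub> c"
      using rc 1(4) by blast
    thus ?thesis
      using 1(2) GD(2)[OF 1(3)] by (simp flip: \<open>\<ominus>\<^bsub>E\<^esub> v = r \<odot>\<^bsub>E\<^esub> c\<close> add: E.M.r_neg)
  qed
  have "G' \<subseteq> carrier Y \<times> carrier E"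
    unfolding G'_def using GD(1,2) y c(1) by (auto simp: Y.smult_closed E.smult_closed)
  hence "linear_graph R Y E G'"
    unfolding linear_graph_def using GG' GD(3) by (intro conjI allI ballI impI add mult zero) auto
  moreover have "(y, c) \<in> G'"
    using G'I[OF GD(3), of "\<one>\<^bsub>R\<^esub>"] y c(1) by (simp add: Y.smult_one E.smult_one)
  ultimately show thesis
    using that GG' by blast
qed

end

text \<open>
  Zorn's lemma gives a maximal linear graph above the one that sends \<open>i x\<close> to \<open>f x\<close>.  Since every
  linear graph can be extended to one more point, the maximal one is total.
\<close>

lemma baer_imp_injective:
  fixes R :: "('r, 'x) ring_scheme"
  assumes E: "left_module R E" and baer: "baer_condition R E"
  shows "injective_module TYPE('w) R E"
proof (rule injective_moduleI[OF E])
  fix X Y :: "('r, 'w) module" and i f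
  assume X: "left_module R X" and Y: "left_module R Y"
    and i: "i \<in> module_hom R X Y" and inj: "inj_on i (carrier X)" and f: "f \<in> module_hom R X E"
  interpret two_modules R Y E
    using Y E by (simp add: two_modules_def)
  interpret X: left_module R X by fact
  define G0 where "G0 = (\<lambda>x. (i x, f x)) ` carrier X"
  have i0: "i \<zero>\<^bsub>X\<^esub> = \<zero>\<^bsub>Y\<^esub>" and f0: "f \<zero>\<^bsub>X\<^esub> = \<zero>\<^bsub>E\<^esub>"
    using module_hom_zero[OF i X Y] module_hom_zero[OF f X E] by auto
  have G0: "linear_graph R Y E G0"
    unfolding linear_graph_def
  proof (intro conjI allI ballI impI)
    show "G0 \<subseteq> carrier Y \<times> carrier E"
      by (auto simp: G0_def module_hom_closed[OF i] module_hom_closed[OF f])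
    show "(\<zero>\<^bsub>Y\<^esub>, \<zero>\<^bsub>E\<^esub>) \<in> G0"
      unfolding G0_def using i0 f0 by (intro image_eqI[of _ _ "\<zero>\<^bsub>X\<^esub>"]) auto
  next
    fix y u y' u' assume "(y, u) \<in> G0" "(y', u') \<in> G0"
    then obtain x x' where "x \<in> carrier X" "x' \<in> carrier X" "y = i x" "u = f x" "y' = i x'" "u' = f x'"
      by (auto simp: G0_def)
    thus "(y \<oplus>\<^bsub>Y\<^esub> y', u \<oplus>\<^bsub>E\<^esub> u') \<in> G0"
      unfolding G0_def
      by (intro image_eqI[of _ _ "x \<oplus>\<^bsub>X\<^esub> x'"]) (auto simp: module_hom_add[OF i] module_hom_add[OF f])
  next
    fix r y u assume r: "r \<in> carrier R" and "(y, u) \<in> G0"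
    then obtain x where "x \<in> carrier X" "y = i x" "u = f x"
      by (auto simp: G0_def)
    thus "(r \<odot>\<^bsub>Y\<^esub> y, r \<odot>\<^bsub>E\<^esub> u) \<in> G0"
      unfolding G0_def using r
      by (intro image_eqI[of _ _ "r \<odot>\<^bsub>X\<^esub> x"])
         (auto simp: module_hom_smult[OF i] module_hom_smult[OF f] X.smult_closed)
  next
    fix u assume "(\<zero>\<^bsub>Y\<^esub>, u) \<in> G0"
    then obtain x where "x \<in> carrier X" "i x = i \<zero>\<^bsub>X\<^esub>" "u = f x"
      using i0 by (auto simp: G0_def)
    thus "u = \<zero>\<^bsub>E\<^esub>"
      using inj_onD[OF inj, of x "\<zero>\<^bsub>X\<^esub>"] f0 by simp
  qed
  let ?A = "{G. linear_graph R Y E G \<and> G0 \<subseteq> G}"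
  have "\<exists>G\<in>?A. \<forall>H\<in>?A. G \<subseteq> H \<longrightarrow> H = G"
  proof (rule subset_Zorn_nonempty)
    show "?A \<noteq> {}" using G0 by blast
    fix C assume C: "C \<noteq> {}" "subset.chain ?A C"
    hence "subset.chain {G. linear_graph R Y E G} C"
      unfolding subset_chain_def by blast
    hence "linear_graph R Y E (\<Union>C)"
      by (rule linear_graph_Union[OF C(1)])
    moreover have "G0 \<subseteq> \<Union>C"
      using C unfolding subset_chain_def by blast
    ultimately show "\<Union>C \<in> ?A" by blast
  qed
  then obtain G where G: "linear_graph R Y E G" and G0G: "G0 \<subseteq> G"
    and max: "\<And>H. \<lbrakk>linear_graph R Y E H; G0 \<subseteq> H; G \<subseteq> H\<rbrakk> \<Longrightarrow> H = G"
    by auto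
  have total: "\<exists>u. (y, u) \<in> G" if y: "y \<in> carrier Y" for y
  proof -
    obtain H u where H: "linear_graph R Y E H" "G \<subseteq> H" "(y, u) \<in> H"
      by (rule linear_graph_extend_at[OF baer G y])
    thus ?thesis
      using max[of H] G0G by blast
  qed
  define g where "g y = (THE u. (y, u) \<in> G)" for y
  have g: "g y = u" if "(y, u) \<in> G" for y u
    unfolding g_def using that linear_graph_functional[OF G] by blast
  have gG: "(y, g y) \<in> G" if "y \<in> carrier Y" for y
    using total[OF that] g by auto
  have "g \<in> module_hom R Y E"
  proof (rule module_homI)
    show "g y \<in> carrier E" if "y \<in> carrier Y" for y
      by (rule linear_graphD(2)[OF G gG[OF that]])
    show "g (y \<oplus>\<^bsub>Y\<^esub> z) = g y \<oplus>\<^bsub>E\<^esub> g z" if "y \<in> carrier Y" "z \<in> carrier Y" for y z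
      by (rule g[OF linear_graphD(4)[OF G gG[OF that(1)] gG[OF that(2)]]])
    show "g (r \<odot>\<^bsub>Y\<^esub> y) = r \<odot>\<^bsub>E\<^esub> g y" if "r \<in> carrier R" "y \<in> carrier Y" for r y
      by (rule g[OF linear_graphD(5)[OF G that(1) gG[OF that(2)]]])
  qed
  moreover have "g (i x) = f x" if "x \<in> carrier X" for x
    by (rule g) (use that G0G in \<open>auto simp: G0_def\<close>)
  ultimately show "\<exists>g \<in> module_hom R Y E. \<forall>x\<in>carrier X. g (i x) = f x"
    by blast
qed

text \<open>
  Baer's condition speaks only of left ideals of \<open>R\<close>, hence does not depend on the universe of
  test modules.
\<close>

lemma injective_module_any_universe:
  fixes R :: "('r, 'x) ring_scheme" and \<epsilon> :: "'r \<Rightarrow> 'u"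
  assumes "injective_module TYPE('u) R E" "inj \<epsilon>"
  shows "injective_module TYPE('w) R E"
proof (rule baer_imp_injective)
  show "left_module R E"
    using assms(1) by (simp add: injective_module_def)
  show "baer_condition R E"
    by (rule injective_imp_baer[OF assms])
qed

section \<open>Maps out of a tensor product\<close>

lemma minus_zero_imp_eq:
  assumes "abelian_group X" "a \<in> carrier X" "b \<in> carrier X" "a \<ominus>\<^bsub>X\<^esub> b = \<zero>\<^bsub>X\<^esub>"
  shows "a = b"
proof -
  interpret X: abelian_group X by fact
  show ?thesis
    using assms X.minus_equality[of a "\<ominus>\<^bsub>X\<^esub> b"] by (simp add: a_minus_def)
qed

lemma add_minus_minus:
  assumes "abelian_group X" "a \<in> carrier X" "b \<in> carrier X"
  shows "a \<oplus>\<^bsub>X\<^esub> b \<oplus>\<^bsub>X\<^esub> \<ominus>\<^bsub>X\<^esub> a \<oplus>\<^bsub>X\<^esub> \<ominus>\<^bsub>X\<^esub> b = \<zero>\<^bsub>X\<^esub>"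
proof -
  interpret X: abelian_group X by fact
  show ?thesis
    using assms X.r_neg[of "a \<oplus>\<^bsub>X\<^esub> b"] by (simp add: X.minus_add X.a_assoc)
qed

lemma minus_minus_zero_imp_eq:
  assumes "abelian_group X" "a \<in> carrier X" "b \<in> carrier X" "c \<in> carrier X"
    "a \<ominus>\<^bsub>X\<^esub> b \<ominus>\<^bsub>X\<^esub> c = \<zero>\<^bsub>X\<^esub>"
  shows "a = b \<oplus>\<^bsub>X\<^esub> c"
proof -
  interpret X: abelian_group X by fact
  have "a \<ominus>\<^bsub>X\<^esub> b = c"
    by (rule minus_zero_imp_eq[OF assms(1) _ assms(4,5)]) (use assms(2,3) in simp)
  hence c: "c = a \<oplus>\<^bsub>X\<^esub> \<ominus>\<^bsub>X\<^esub> b"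
    by (simp add: a_minus_def)
  show ?thesis
    unfolding c using assms(2,3) by (simp add: X.a_lcomm[of b a] X.r_neg)
qed

lemma keys_minus_subset:
  "\<lbrakk>Poly_Mapping.keys a \<subseteq> K; Poly_Mapping.keys b \<subseteq> K\<rbrakk> \<Longrightarrow> Poly_Mapping.keys (a - b) \<subseteq> K"
  for a b :: "'k \<Rightarrow>\<^sub>0 int"
  using keys_diff[of a b] by auto

lemma hom_free_Abelian_group_minus:
  assumes "abelian_group X" and h: "h \<in> hom (free_Abelian_group K) (add_monoid X)"
    and "Poly_Mapping.keys a \<subseteq> K" "Poly_Mapping.keys b \<subseteq> K"
  shows "h (a - b) = h a \<ominus>\<^bsub>X\<^esub> h b"
proof -
  interpret X: abelian_group X by fact
  interpret h: group_hom "free_Abelian_group K" "add_monoid X" h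
    using h X.a_group by (simp add: group_hom_def group_hom_axioms_def)
  have "h (a \<otimes>\<^bsub>free_Abelian_group K\<^esub> inv\<^bsub>free_Abelian_group K\<^esub> b) = h a \<oplus>\<^bsub>X\<^esub> \<ominus>\<^bsub>X\<^esub> h b"
    using assms(3,4) h.hom_inv[of b] by (subst h.hom_mult) (simp_all add: a_inv_def)
  thus ?thesis
    using assms(3,4) by (simp add: a_minus_def)
qed

text \<open>
  Identifies the sum over the keys of a formal combination, which is how \<open>tensor_lift\<close> evaluates
  representatives, with the homomorphism given by the universal property of the free group.
\<close>

lemma hom_free_Abelian_group_eq_finsum:
  assumes "abelian_group X" and h: "h \<in> hom (free_Abelian_group K) (add_monoid X)"
    and c: "Poly_Mapping.keys c \<subseteq> K"
  shows "h c = (\<Oplus>\<^bsub>X\<^esub>k\<in>Poly_Mapping.keys c. [Poly_Mapping.lookup c k] \<cdot>\<^bsub>X\<^esub> h (frag_of k))"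
proof -
  interpret X: abelian_group X by fact
  let ?F = "free_Abelian_group K"
  interpret h: group_hom ?F "add_monoid X" h
    using h X.a_group by (simp add: group_hom_def group_hom_axioms_def)
  define n where "n = Poly_Mapping.lookup c"
  have pow: "h (frag_cmul i (frag_of k)) = [i] \<cdot>\<^bsub>X\<^esub> h (frag_of k)" if "k \<in> K" for i k
    using h.hom_int_pow[of "frag_of k" i] that by (simp add: add_pow_def)
  have closed: "h (frag_of k) \<in> carrier X" if "k \<in> K" for k
    using h.hom_closed[of "frag_of k"] that by simp
  have "Poly_Mapping.keys (\<Sum>k\<in>J. frag_cmul (n k) (frag_of k)) \<subseteq> K \<and>
     h (\<Sum>k\<in>J. frag_cmul (n k) (frag_of k)) = (\<Oplus>\<^bsub>X\<^esub>k\<in>J. [n k] \<cdot>\<^bsub>X\<^esub> h (frag_of k))"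
    if "finite J" "J \<subseteq> K" for J
    using that
  proof (induction J rule: finite_induct)
    case empty
    show ?case using h.hom_one by simp
  next
    case (insert k J)
    let ?s = "\<Sum>k\<in>J. frag_cmul (n k) (frag_of k)"
    have s: "Poly_Mapping.keys ?s \<subseteq> K" and hs: "h ?s = (\<Oplus>\<^bsub>X\<^esub>k\<in>J. [n k] \<cdot>\<^bsub>X\<^esub> h (frag_of k))"
      using insert by auto
    have k: "k \<in> K" "Poly_Mapping.keys (frag_cmul (n k) (frag_of k)) \<subseteq> K"
      using insert.prems keys_cmul[of "n k" "frag_of k"] by (auto simp: keys_frag_of)
    have "h (frag_cmul (n k) (frag_of k) + ?s) = [n k] \<cdot>\<^bsub>X\<^esub> h (frag_of k) \<oplus>\<^bsub>X\<^esub> h ?s"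
      using h.hom_mult[of "frag_cmul (n k) (frag_of k)" ?s] k s pow[of k] by simp
    moreover have "(\<Oplus>\<^bsub>X\<^esub>k\<in>insert k J. [n k] \<cdot>\<^bsub>X\<^esub> h (frag_of k))
        = [n k] \<cdot>\<^bsub>X\<^esub> h (frag_of k) \<oplus>\<^bsub>X\<^esub> (\<Oplus>\<^bsub>X\<^esub>k\<in>J. [n k] \<cdot>\<^bsub>X\<^esub> h (frag_of k))"
      using insert closed by (intro X.finsum_insert) (auto simp: X.add.int_pow_closed)
    ultimately show ?case
      using insert hs keys_add[of "frag_cmul (n k) (frag_of k)" ?s] k(2) s by auto
  qed
  from this[of "Poly_Mapping.keys c"] c show ?thesis
    using frag_expansion[of c] by (simp add: frag_extend_def n_def)
qed

definition balanced_map ::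
  "('s, 'x) ring_scheme \<Rightarrow> ('r, 's, 'm, 'y) bimodule_scheme \<Rightarrow> ('s, 'p, 'z) module_scheme
    \<Rightarrow> ('c, 'w) ring_scheme \<Rightarrow> ('m \<Rightarrow> 'p \<Rightarrow> 'c) \<Rightarrow> bool" where
  "balanced_map S M P X \<beta> \<longleftrightarrow>
     (\<forall>m\<in>carrier M. \<forall>p\<in>carrier P. \<beta> m p \<in> carrier X) \<and>
     (\<forall>m\<in>carrier M. \<forall>m'\<in>carrier M. \<forall>p\<in>carrier P. \<beta> (m \<oplus>\<^bsub>M\<^esub> m') p = \<beta> m p \<oplus>\<^bsub>X\<^esub> \<beta> m' p) \<and>
     (\<forall>m\<in>carrier M. \<forall>p\<in>carrier P. \<forall>p'\<in>carrier P. \<beta> m (p \<oplus>\<^bsub>P\<^esub> p') = \<beta> m p \<oplus>\<^bsub>X\<^esub> \<beta> m p') \<and>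
     (\<forall>m\<in>carrier M. \<forall>s\<in>carrier S. \<forall>p\<in>carrier P. \<beta> (m \<triangleleft>\<^bsub>M\<^esub> s) p = \<beta> m (s \<odot>\<^bsub>P\<^esub> p))"

locale tensor_product = M: bimodule R S M + P: left_module S P
  for R :: "('r, 'x) ring_scheme" and S :: "('s, 'z) ring_scheme"
    and M :: "('r, 's, 'm, 'y) bimodule_scheme" and P :: "('s, 'p, 'w) module_scheme"
begin

abbreviation "F \<equiv> free_Abelian_group (carrier M \<times> carrier P)"
abbreviation "H \<equiv> tensor_subgroup S M P"
abbreviation "T \<equiv> tensor_group S M P"
abbreviation pure (infix \<open>\<otimes>t\<close> 70) where "m \<otimes>t p \<equiv> pure_tensor S M P m p"

lemma relations_in_free_group: "tensor_relations S M P \<subseteq> carrier F"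
proof
  fix c assume "c \<in> tensor_relations S M P"
  hence "Poly_Mapping.keys c \<subseteq> carrier M \<times> carrier P"
    unfolding tensor_relations_def
    by (elim UnE CollectE exE conjE)
       (simp_all add: keys_minus_subset keys_frag_of M.rsmult_closed P.smult_closed)
  thus "c \<in> carrier F" by simp
qed

lemma tensor_subgroup_normal: "H \<lhd> F"
  unfolding tensor_subgroup_def
  by (intro comm_group.subgroup_imp_normal abelian_free_Abelian_group
      group.generate_is_subgroup relations_in_free_group) simp

lemma tensor_group_monoid: "add_monoid T = F Mod H"
  by (simp add: tensor_group_def tensor_quotient_def FactGroup_def)

lemma abelian_group_tensor: "abelian_group T"
proof -
  have "comm_group (F Mod H)"
    by (intro comm_group.abelian_FactGroup abelian_free_Abelian_group normal_imp_subgroup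
        tensor_subgroup_normal)
  hence "comm_group (add_monoid T)"
    by (simp only: tensor_group_monoid)
  thus ?thesis
    by (simp add: abelian_group_def abelian_monoid_def abelian_group_axioms_def comm_group_def)
qed

sublocale T: abelian_group T by (rule abelian_group_tensor)

lemma coset_hom: "(\<lambda>c. H #>\<^bsub>F\<^esub> c) \<in> hom F (add_monoid T)"
  using normal.r_coset_hom_Mod[OF tensor_subgroup_normal] by (simp only: tensor_group_monoid)

lemma coset_closed: "Poly_Mapping.keys c \<subseteq> carrier M \<times> carrier P \<Longrightarrow> H #>\<^bsub>F\<^esub> c \<in> carrier T"
  using hom_in_carrier[OF coset_hom, of c] by simp

lemma coset_relation:
  assumes "c \<in> tensor_relations S M P"
  shows "H #>\<^bsub>F\<^esub> c = \<zero>\<^bsub>T\<^esub>"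
proof -
  have "c \<in> H"
    unfolding tensor_subgroup_def by (rule generate.incl[OF assms])
  hence "H #>\<^bsub>F\<^esub> c = H"
    by (intro subgroup.rcos_const normal_imp_subgroup tensor_subgroup_normal) simp_all
  thus ?thesis
    by (simp add: tensor_group_def tensor_quotient_def FactGroup_def)
qed

lemma coset_minus:
  "\<lbrakk>Poly_Mapping.keys a \<subseteq> carrier M \<times> carrier P; Poly_Mapping.keys b \<subseteq> carrier M \<times> carrier P\<rbrakk>
    \<Longrightarrow> H #>\<^bsub>F\<^esub> (a - b) = (H #>\<^bsub>F\<^esub> a) \<ominus>\<^bsub>T\<^esub> (H #>\<^bsub>F\<^esub> b)"
  by (rule hom_free_Abelian_group_minus[OF abelian_group_tensor coset_hom])

lemma pure_closed: "\<lbrakk>m \<in> carrier M; p \<in> carrier P\<rbrakk> \<Longrightarrow> m \<otimes>t p \<in> carrier T"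
  unfolding pure_tensor_def by (rule coset_closed) (simp add: keys_frag_of)

lemma balanced_map_pure: "balanced_map S M P T (\<otimes>t)"
  unfolding balanced_map_def
proof (intro conjI ballI)
  fix m m' p assume *: "m \<in> carrier M" "m' \<in> carrier M" "p \<in> carrier P"
  have "frag_of (m \<oplus>\<^bsub>M\<^esub> m', p) - frag_of (m, p) - frag_of (m', p) \<in> tensor_relations S M P"
    unfolding tensor_relations_def using * by blast
  from coset_relation[OF this] show "(m \<oplus>\<^bsub>M\<^esub> m') \<otimes>t p = m \<otimes>t p \<oplus>\<^bsub>T\<^esub> m' \<otimes>t p"
    using *
    by - (rule minus_minus_zero_imp_eq[OF abelian_group_tensor],
       simp_all add: keys_minus_subset pure_closed coset_minus keys_frag_of pure_tensor_def coset_closed)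
next
  fix m p p' assume *: "m \<in> carrier M" "p \<in> carrier P" "p' \<in> carrier P"
  have "frag_of (m, p \<oplus>\<^bsub>P\<^esub> p') - frag_of (m, p) - frag_of (m, p') \<in> tensor_relations S M P"
    unfolding tensor_relations_def using * by blast
  from coset_relation[OF this] show "m \<otimes>t (p \<oplus>\<^bsub>P\<^esub> p') = m \<otimes>t p \<oplus>\<^bsub>T\<^esub> m \<otimes>t p'"
    using *
    by - (rule minus_minus_zero_imp_eq[OF abelian_group_tensor],
       simp_all add: keys_minus_subset pure_closed coset_minus keys_frag_of pure_tensor_def coset_closed)
next
  fix m s p assume *: "m \<in> carrier M" "s \<in> carrier S" "p \<in> carrier P"
  have "frag_of (m \<triangleleft>\<^bsub>M\<^esub> s, p) - frag_of (m, s \<odot>\<^bsub>P\<^esub> p) \<in> tensor_relations S M P"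
    unfolding tensor_relations_def using * by blast
  from coset_relation[OF this] show "(m \<triangleleft>\<^bsub>M\<^esub> s) \<otimes>t p = m \<otimes>t (s \<odot>\<^bsub>P\<^esub> p)"
    using * M.rsmult_closed[of m s] P.smult_closed[of s p]
    by - (rule minus_zero_imp_eq[OF abelian_group_tensor],
       simp_all add: keys_minus_subset pure_closed coset_minus keys_frag_of pure_tensor_def coset_closed
          M.rsmult_closed P.smult_closed)
qed (simp add: pure_closed)

lemma tensor_induct [consumes 1, case_names zero pure minus]:
  assumes t: "t \<in> carrier T" and zero: "Q \<zero>\<^bsub>T\<^esub>"
    and pure: "\<And>m p. \<lbrakk>m \<in> carrier M; p \<in> carrier P\<rbrakk> \<Longrightarrow> Q (m \<otimes>t p)"
    and minus: "\<And>t u. \<lbrakk>t \<in> carrier T; u \<in> carrier T; Q t; Q u\<rbrakk> \<Longrightarrow> Q (t \<ominus>\<^bsub>T\<^esub> u)"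
  shows "Q t"
proof -
  obtain c where c: "Poly_Mapping.keys c \<subseteq> carrier M \<times> carrier P" "t = H #>\<^bsub>F\<^esub> c"
    using t by (auto simp: tensor_group_def tensor_quotient_def FactGroup_def RCOSETS_def)
  have "Q (H #>\<^bsub>F\<^esub> c)"
    using c(1)
  proof (rule free_Abelian_group_induct)
    show "Q (H #>\<^bsub>F\<^esub> 0)"
      using zero coset_minus[of 0 0] coset_closed[of 0] by (simp add: T.r_neg a_minus_def)
    show "Q (H #>\<^bsub>F\<^esub> frag_of k)" if "k \<in> carrier M \<times> carrier P" for k
      using that pure by (auto simp: pure_tensor_def)
  qed (simp add: coset_minus coset_closed minus)
  thus ?thesis
    using c(2) by simp
qed

text \<open>
  The homomorphism \<open>h\<close> from the free abelian group that extends \<open>\<beta>\<close> kills all tensor relations because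
  \<open>\<beta>\<close> is balanced, hence is constant on cosets.  So the image whose only element \<open>tensor_lift\<close>
  selects is indeed a singleton, and on the coset of a pair it contains the value of \<open>\<beta>\<close>.
\<close>

lemma tensor_lift_pure:
  assumes X: "abelian_group X" and \<beta>: "balanced_map S M P X \<beta>"
    and mp: "m \<in> carrier M" "p \<in> carrier P"
  shows "tensor_lift X \<beta> (m \<otimes>t p) = \<beta> m p"
proof -
  interpret X: abelian_group X by fact
  let ?K = "carrier M \<times> carrier P"
  have "(\<lambda>k. \<beta> (fst k) (snd k)) ` ?K \<subseteq> carrier (add_monoid X)"
    using \<beta> by (auto simp: balanced_map_def)
  then obtain h where h: "h \<in> hom F (add_monoid X)"
    and h_of: "\<And>k. k \<in> ?K \<Longrightarrow> h (frag_of k) = \<beta> (fst k) (snd k)"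
    using comm_group.free_Abelian_group_universal[OF X.a_comm_group] by blast
  interpret h: group_hom F "add_monoid X" h
    using h X.a_group by (simp add: group_hom_def group_hom_axioms_def)
  note h_minus = hom_free_Abelian_group_minus[OF X h]
  have h_rel: "h c = \<zero>\<^bsub>X\<^esub>" if "c \<in> tensor_relations S M P" for c
    using that \<beta> unfolding tensor_relations_def balanced_map_def
    by (elim UnE CollectE exE conjE)
       (simp_all add: h_minus keys_minus_subset keys_frag_of h_of M.rsmult_closed P.smult_closed
         add_minus_minus[OF X] X.r_neg a_minus_def)
  have h_H: "h c = \<zero>\<^bsub>X\<^esub>" if "c \<in> H" for c
  proof -
    have "c \<in> carrier F \<and> h c = \<zero>\<^bsub>X\<^esub>"
      using that unfolding tensor_subgroup_def
    proof induction
      case one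
      show ?case using h.hom_one by simp
    next
      case (incl c)
      show ?case using h_rel[OF incl] relations_in_free_group incl by blast
    next
      case (inv c)
      have c: "c \<in> carrier F" "h c = \<zero>\<^bsub>X\<^esub>"
        using h_rel[OF inv] relations_in_free_group inv by blast+
      show ?case using c h.hom_inv[OF c(1)] by (simp flip: a_inv_def)
    next
      case (eng c d)
      show ?case using eng h.hom_mult[of c d] h.G.m_closed[of c d] by simp
    qed
    thus ?thesis ..
  qed
  have H_sub: "H \<subseteq> carrier F"
    by (rule subgroup.subset[OF normal_imp_subgroup[OF tensor_subgroup_normal]])
  have lift: "tensor_lift X \<beta> (H #>\<^bsub>F\<^esub> c) = h c" if c: "c \<in> carrier F" for c
  proof -
    have "(\<Oplus>\<^bsub>X\<^esub>k\<in>Poly_Mapping.keys z. [Poly_Mapping.lookup z k] \<cdot>\<^bsub>X\<^esub> \<beta> (fst k) (snd k)) = h c"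
      if "z \<in> H #>\<^bsub>F\<^esub> c" for z
    proof -
      obtain d where d: "d \<in> H" "z = d \<otimes>\<^bsub>F\<^esub> c"
        using \<open>z \<in> H #>\<^bsub>F\<^esub> c\<close> by (auto simp: r_coset_def)
      have z: "z \<in> carrier F"
        using d H_sub c h.G.m_closed by blast
      have "(\<Oplus>\<^bsub>X\<^esub>k\<in>Poly_Mapping.keys z. [Poly_Mapping.lookup z k] \<cdot>\<^bsub>X\<^esub> \<beta> (fst k) (snd k)) =
          (\<Oplus>\<^bsub>X\<^esub>k\<in>Poly_Mapping.keys z. [Poly_Mapping.lookup z k] \<cdot>\<^bsub>X\<^esub> h (frag_of k))"
        using z h_of h.hom_closed[of "frag_of _"]
        by (intro X.finsum_cong') (auto intro!: X.add.int_pow_closed)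
      also have "\<dots> = h z"
        using z by (intro hom_free_Abelian_group_eq_finsum[OF X h, symmetric]) simp
      also have "\<dots> = h c"
        using h.hom_mult[of d c] d H_sub c h_H[of d] h.hom_closed[OF c] by auto
      finally show ?thesis .
    qed
    moreover have "c \<in> H #>\<^bsub>F\<^esub> c"
      by (rule group.rcos_self[OF _ c normal_imp_subgroup[OF tensor_subgroup_normal]]) simp
    ultimately have "(\<lambda>c. \<Oplus>\<^bsub>X\<^esub>k\<in>Poly_Mapping.keys c. [Poly_Mapping.lookup c k] \<cdot>\<^bsub>X\<^esub> \<beta> (fst k) (snd k))
        ` (H #>\<^bsub>F\<^esub> c) = {h c}"
      by force
    thus ?thesis
      by (simp add: tensor_lift_def)
  qed
  show ?thesis
    using mp lift[of "frag_of (m, p)"] h_of[of "(m, p)"] by (simp add: pure_tensor_def)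
qed

end

section \<open>Bimodules that induce an equivalence\<close>

text \<open>
  The regular module is generated by \<open>1\<close>, and a map out of it lifts along a surjection once the
  image of \<open>1\<close> does.
\<close>

lemma regular_fg_projective:
  fixes R :: "('r, 'x) ring_scheme" and \<epsilon> :: "'r \<Rightarrow> 'u"
  assumes R: "ring R" and \<epsilon>: "inj_on \<epsilon> (carrier R)"
  shows "fg_projective TYPE('u) R (copy_module \<epsilon> (regular R))"
proof -
  interpret R: ring R by fact
  let ?P = "copy_module \<epsilon> (regular R)" and ?\<nu> = "inv_into (carrier R) \<epsilon>"
  have \<epsilon>': "inj_on \<epsilon> (carrier (regular R))"
    using \<epsilon> by simp
  note P = left_module_copy[OF R.left_module_regular \<epsilon>']
  interpret P: left_module R ?P by (rule P)
  note \<epsilon>_hom = copy_module_hom[OF R.left_module_regular \<epsilon>']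
    and \<nu>_hom = copy_module_hom_inv[OF R.left_module_regular \<epsilon>']
  have one: "\<epsilon> \<one>\<^bsub>R\<^esub> \<in> carrier ?P"
    by (simp add: carrier_copy_module)
  have gen: "?\<nu> x \<in> carrier R \<and> x = ?\<nu> x \<odot>\<^bsub>?P\<^esub> \<epsilon> \<one>\<^bsub>R\<^esub>" if x: "x \<in> carrier ?P" for x
  proof -
    have a: "?\<nu> x \<in> carrier R" "\<epsilon> (?\<nu> x) = x"
      using x by (auto simp: carrier_copy_module inv_into_into f_inv_into_f)
    thus ?thesis
      using module_hom_smult[OF \<epsilon>_hom, of "?\<nu> x" "\<one>\<^bsub>R\<^esub>"] by simp
  qed
  have "projective_module TYPE('u) R ?P"
    unfolding projective_module_def
  proof (intro conjI allI impI P, elim conjE)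
    fix X Y :: "('r, 'u) module" and p f
    assume X: "left_module R X" and Y: "left_module R Y" and p: "p \<in> module_hom R X Y"
      and surj: "p ` carrier X = carrier Y" and f: "f \<in> module_hom R ?P Y"
    interpret X: left_module R X by fact
    have "f (\<epsilon> \<one>\<^bsub>R\<^esub>) \<in> p ` carrier X"
      using surj module_hom_closed[OF f one] by simp
    then obtain x0 where x0: "x0 \<in> carrier X" "p x0 = f (\<epsilon> \<one>\<^bsub>R\<^esub>)"
      by (metis imageE)
    have "(\<lambda>a. a \<odot>\<^bsub>X\<^esub> x0) \<in> module_hom R (regular R) X"
      using x0 by (intro module_homI) (simp_all add: X.smult_closed X.smult_l_distr X.smult_assoc)
    from module_hom_comp[OF \<nu>_hom this] have "(\<lambda>x. ?\<nu> x \<odot>\<^bsub>X\<^esub> x0) \<in> module_hom R ?P X"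
      by simp
    moreover have "p (?\<nu> x \<odot>\<^bsub>X\<^esub> x0) = f x" if "x \<in> carrier ?P" for x
      using gen[OF that] x0 module_hom_smult[OF p, of "?\<nu> x" x0] module_hom_smult[OF f, of "?\<nu> x", OF _ one]
      by simp
    ultimately show "\<exists>g\<in>module_hom R ?P X. \<forall>x\<in>carrier ?P. p (g x) = f x"
      by (intro bexI[of _ "\<lambda>x. ?\<nu> x \<odot>\<^bsub>X\<^esub> x0"]) simp_all
  qed
  moreover have "finitely_generated R ?P"
    unfolding finitely_generated_def
  proof (intro exI[of _ "{\<epsilon> \<one>\<^bsub>R\<^esub>}"] conjI ballI)
    fix x assume x: "x \<in> carrier ?P"
    have "(\<Oplus>\<^bsub>?P\<^esub>g\<in>{\<epsilon> \<one>\<^bsub>R\<^esub>}. ?\<nu> x \<odot>\<^bsub>?P\<^esub> g) = ?\<nu> x \<odot>\<^bsub>?P\<^esub> \<epsilon> \<one>\<^bsub>R\<^esub> \<oplus>\<^bsub>?P\<^esub> \<zero>\<^bsub>?P\<^esub>"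
      using P.smult_closed[OF conjunct1[OF gen[OF x]] one] by (subst P.M.finsum_insert) auto
    also have "\<dots> = x"
      using P.smult_closed[OF conjunct1[OF gen[OF x]] one] conjunct2[OF gen[OF x]] by simp
    finally show "\<exists>c\<in>{\<epsilon> \<one>\<^bsub>R\<^esub>} \<rightarrow> carrier R. x = (\<Oplus>\<^bsub>?P\<^esub>g\<in>{\<epsilon> \<one>\<^bsub>R\<^esub>}. c g \<odot>\<^bsub>?P\<^esub> g)"
      using gen[OF x] x by (intro bexI[of _ "\<lambda>_. ?\<nu> x"]) auto
  qed (use one in auto)
  ultimately show ?thesis
    by (simp add: fg_projective_def)
qed

context tensor_product
begin

lemma tensor_module_simps:
  "carrier (tensor_module S M P) = carrier T" "add (tensor_module S M P) = add T"
  "smult (tensor_module S M P) r = tensor_lift T (\<lambda>m p. (r \<odot>\<^bsub>M\<^esub> m) \<otimes>t p)"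
  by (simp_all add: tensor_module_def Let_def)

lemma pure_rules:
  shows pure_add_left: "\<lbrakk>m \<in> carrier M; m' \<in> carrier M; p \<in> carrier P\<rbrakk>
      \<Longrightarrow> (m \<oplus>\<^bsub>M\<^esub> m') \<otimes>t p = m \<otimes>t p \<oplus>\<^bsub>T\<^esub> m' \<otimes>t p"
    and pure_add_right: "\<lbrakk>m \<in> carrier M; p \<in> carrier P; p' \<in> carrier P\<rbrakk>
      \<Longrightarrow> m \<otimes>t (p \<oplus>\<^bsub>P\<^esub> p') = m \<otimes>t p \<oplus>\<^bsub>T\<^esub> m \<otimes>t p'"
    and pure_balanced: "\<lbrakk>m \<in> carrier M; s \<in> carrier S; p \<in> carrier P\<rbrakk>
      \<Longrightarrow> (m \<triangleleft>\<^bsub>M\<^esub> s) \<otimes>t p = m \<otimes>t (s \<odot>\<^bsub>P\<^esub> p)"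
  using balanced_map_pure by (simp_all add: balanced_map_def)

lemma smult_pure:
  assumes "r \<in> carrier R" "m \<in> carrier M" "p \<in> carrier P"
  shows "r \<odot>\<^bsub>tensor_module S M P\<^esub> (m \<otimes>t p) = (r \<odot>\<^bsub>M\<^esub> m) \<otimes>t p"
proof -
  have "balanced_map S M P T (\<lambda>m p. (r \<odot>\<^bsub>M\<^esub> m) \<otimes>t p)"
    using assms(1) unfolding balanced_map_def
    by (simp add: pure_closed pure_add_left pure_add_right M.smult_closed M.smult_r_distr
        M.smult_rsmult[symmetric] pure_balanced)
  thus ?thesis
    using assms(2,3) by (simp add: tensor_module_simps tensor_lift_pure[OF abelian_group_tensor])
qed

end

text \<open>
  The canonical isomorphism between \<open>M\<close> and its tensor product with \<open>S\<close>, for a copy of \<open>S\<close>.  It is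
  surjective since every pure tensor can be brought to the form \<open>m \<otimes> 1\<close>, and injective since the
  multiplication \<open>m \<otimes> a \<mapsto> m a\<close> is a left inverse.
\<close>

lemma tensor_regular_iso:
  fixes \<epsilon> :: "'s \<Rightarrow> 'u" and R :: "('r, 'x) ring_scheme" and S :: "('s, 'z) ring_scheme"
    and M :: "('r, 's, 'm, 'y) bimodule_scheme"
  assumes bimod: "bimodule R S M" and \<epsilon>: "inj_on \<epsilon> (carrier S)"
  defines "P \<equiv> copy_module \<epsilon> (regular S)"
  shows "(\<lambda>m. pure_tensor S M P m (\<epsilon> \<one>\<^bsub>S\<^esub>)) \<in> module_iso R M (tensor_module S M P)"
    and "\<lbrakk>m \<in> carrier M; a \<in> carrier S\<rbrakk>
      \<Longrightarrow> pure_tensor S M P m (\<epsilon> a) = pure_tensor S M P (m \<triangleleft>\<^bsub>M\<^esub> a) (\<epsilon> \<one>\<^bsub>S\<^esub>)"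
proof -
  interpret M: bimodule R S M by fact
  have \<epsilon>': "inj_on \<epsilon> (carrier (regular S))"
    using \<epsilon> by simp
  have P: "left_module S P"
    unfolding P_def by (rule left_module_copy[OF M.S.left_module_regular \<epsilon>'])
  interpret tensor_product R S M P
    using P bimod by (simp add: tensor_product_def)
  note \<epsilon>_hom = copy_module_hom[OF M.S.left_module_regular \<epsilon>', folded P_def]
  note \<nu>_hom = copy_module_hom_inv[OF M.S.left_module_regular \<epsilon>', folded P_def]
  let ?\<nu> = "inv_into (carrier S) \<epsilon>"
  let ?j = "\<lambda>m. m \<otimes>t \<epsilon> \<one>\<^bsub>S\<^esub>"
  have one: "\<epsilon> \<one>\<^bsub>S\<^esub> \<in> carrier P"
    using module_hom_closed[OF \<epsilon>_hom, of "\<one>\<^bsub>S\<^esub>"] by simp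
  show move: "m \<otimes>t \<epsilon> a = ?j (m \<triangleleft>\<^bsub>M\<^esub> a)" if "m \<in> carrier M" "a \<in> carrier S" for m a
    using that pure_balanced[OF that one] module_hom_smult[OF \<epsilon>_hom, of a "\<one>\<^bsub>S\<^esub>"] by simp
  have hom: "?j \<in> module_hom R M (tensor_module S M P)"
    using one by (intro module_homI) (simp_all add: pure_closed pure_add_left smult_pure tensor_module_simps(1,2))
  have "balanced_map S M P M (\<lambda>m p. m \<triangleleft>\<^bsub>M\<^esub> ?\<nu> p)"
    using module_homD[OF \<nu>_hom] unfolding balanced_map_def
    by (simp add: M.rsmult_closed M.rsmult_l_distr M.rsmult_r_distr M.rsmult_assoc)
  from tensor_lift_pure[OF M.M.abelian_group_axioms this _ one]
  have retract: "tensor_lift M (\<lambda>m p. m \<triangleleft>\<^bsub>M\<^esub> ?\<nu> p) (?j m) = m" if "m \<in> carrier M" for m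
    using that by (simp add: inv_into_f_f[OF \<epsilon>] M.rsmult_one)
  have inj: "inj_on ?j (carrier M)"
    by (rule inj_on_inverseI) (rule retract)
  have surj: "t \<in> ?j ` carrier M" if "t \<in> carrier T" for t
    using that
  proof (induction rule: tensor_induct)
    case zero
    have "?j \<zero>\<^bsub>M\<^esub> \<oplus>\<^bsub>T\<^esub> ?j \<zero>\<^bsub>M\<^esub> = ?j \<zero>\<^bsub>M\<^esub>"
      using one by (simp flip: pure_add_left)
    hence "?j \<zero>\<^bsub>M\<^esub> = \<zero>\<^bsub>T\<^esub>"
      using one by (simp add: pure_closed)
    thus ?case
      by (intro image_eqI[of _ _ "\<zero>\<^bsub>M\<^esub>"]) simp_all
  next
    case (pure m p)
    then obtain a where "a \<in> carrier S" "p = \<epsilon> a"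
      by (auto simp: P_def carrier_copy_module)
    thus ?case
      using move[OF pure(1)] pure(1) by (auto simp: M.rsmult_closed)
  next
    case (minus t u)
    then obtain m m' where m: "m \<in> carrier M" "m' \<in> carrier M" "t = ?j m" "u = ?j m'"
      by blast
    have "?j (m \<ominus>\<^bsub>M\<^esub> m') \<oplus>\<^bsub>T\<^esub> ?j m' = ?j m"
      using m(1,2) one by (simp add: a_minus_def M.M.a_assoc M.M.l_neg flip: pure_add_left)
    hence "?j (m \<ominus>\<^bsub>M\<^esub> m') = t \<ominus>\<^bsub>T\<^esub> u"
      using m one by (metis T.add.inv_solve_right pure_closed M.M.minus_closed a_minus_def minus.hyps)
    thus ?case
      using m(1,2) by (intro image_eqI[of _ _ "m \<ominus>\<^bsub>M\<^esub> m'"]) auto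
  qed
  show "?j \<in> module_iso R M (tensor_module S M P)"
    using hom inj surj one
    by (auto simp: module_iso_def bij_betw_def tensor_module_simps(1) pure_closed)
qed

text \<open>
  The equivalence is evaluated at the projective module \<open>S\<close>.  The tensor functor sends \<open>S\<close> to
  \<open>M\<close>, which is therefore injective; the unit at \<open>S\<close> sends \<open>a\<close> to right multiplication by
  \<open>a\<close>, so its bijectivity says that right multiplication identifies \<open>S\<close> with the endomorphisms of
  the left \<open>R\<close>-module \<open>M\<close>.
\<close>

lemma equivalence_imp_injective_and_endomorphisms:
  fixes \<epsilon> :: "'s \<Rightarrow> 'u" and \<epsilon>' :: "'r \<Rightarrow> 'u"
    and R :: "('r, 'x) ring_scheme" and S :: "('s, 'z) ring_scheme"
    and M :: "('r, 's, 'm, 'y) bimodule_scheme"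
  assumes bimod: "bimodule R S M" and equiv: "adjoint_pair_induces_equivalence TYPE('u) S R M"
    and \<epsilon>: "inj \<epsilon>" and \<epsilon>': "inj \<epsilon>'"
  shows "injective_module TYPE('w) R M"
    and "\<theta> \<in> module_hom R M M \<Longrightarrow> \<exists>!a. a \<in> carrier S \<and> (\<forall>m\<in>carrier M. \<theta> m = m \<triangleleft>\<^bsub>M\<^esub> a)"
proof -
  interpret M: bimodule R S M by fact
  define P where "P = copy_module \<epsilon> (regular S)"
  have inj: "inj_on \<epsilon> (carrier S)"
    using \<epsilon> by (auto intro: inj_on_subset)
  let ?Q = "tensor_module S M P"
  define j where "j m = pure_tensor S M P m (\<epsilon> \<one>\<^bsub>S\<^esub>)" for m
  have j: "j \<in> module_iso R M ?Q"
    unfolding j_def P_def by (rule tensor_regular_iso(1)[OF bimod inj])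
  have move: "pure_tensor S M P m (\<epsilon> a) = j (m \<triangleleft>\<^bsub>M\<^esub> a)" if "m \<in> carrier M" "a \<in> carrier S" for m a
    unfolding j_def P_def by (rule tensor_regular_iso(2)[OF bimod inj that])
  have "fg_projective TYPE('u) S P"
    unfolding P_def by (rule regular_fg_projective[OF M.S.ring_axioms inj])
  hence inj_Q: "injective_module TYPE('u) R ?Q"
    and unit: "adj_unit S M P \<in> module_iso S P (hom_module R M ?Q)"
    using equiv unfolding adjoint_pair_induces_equivalence_def fg_injective_def by blast+
  have jinj: "inj_on j (carrier M)"
    using module_isoD(2)[OF j] by (simp add: bij_betw_def)
  have "injective_module TYPE('u) R M"
    by (rule injective_module_retract[OF inj_Q M.left_module_axioms module_isoD(1)[OF j]
          module_iso_inv[OF j M.left_module_axioms]])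
       (rule inv_into_f_f[OF jinj])
  thus "injective_module TYPE('w) R M"
    using \<epsilon>' by (rule injective_module_any_universe)
  assume \<theta>: "\<theta> \<in> module_hom R M M"
  have carrier_P: "carrier P = \<epsilon> ` carrier S"
    by (simp add: P_def carrier_copy_module)
  \<comment> \<open>Transported along \<open>j\<close>, the endomorphism lies in the target of the unit at \<open>P\<close>.\<close>
  have "restrict (\<lambda>m. j (\<theta> m)) (carrier M) \<in> carrier (hom_module R M ?Q)"
    using module_hom_comp[OF \<theta> module_isoD(1)[OF j]]
    by (auto simp: hom_module_def module_hom_def M.smult_closed)
  then obtain p where p: "p \<in> carrier P" "adj_unit S M P p = restrict (\<lambda>m. j (\<theta> m)) (carrier M)"
    using module_isoD(2)[OF unit] unfolding bij_betw_def by (metis imageE)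
  then obtain a where a: "a \<in> carrier S" "p = \<epsilon> a"
    using carrier_P by blast
  show "\<exists>!a. a \<in> carrier S \<and> (\<forall>m\<in>carrier M. \<theta> m = m \<triangleleft>\<^bsub>M\<^esub> a)"
  proof (intro ex1I[of _ a] conjI ballI a(1))
    fix m assume m: "m \<in> carrier M"
    have "j (\<theta> m) = j (m \<triangleleft>\<^bsub>M\<^esub> a)"
      using fun_cong[OF p(2), of m] m move[OF m a(1)] a(2) by (simp add: adj_unit_def)
    thus "\<theta> m = m \<triangleleft>\<^bsub>M\<^esub> a"
      using inj_onD[OF jinj] m a(1) module_hom_closed[OF \<theta>] M.rsmult_closed by blast
  next
    fix b assume b: "b \<in> carrier S \<and> (\<forall>m\<in>carrier M. \<theta> m = m \<triangleleft>\<^bsub>M\<^esub> b)"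
    have "adj_unit S M P (\<epsilon> b) = adj_unit S M P p"
      unfolding p(2) using b move by (auto simp: adj_unit_def intro!: restrict_ext)
    hence "\<epsilon> b = \<epsilon> a"
      using module_isoD(2)[OF unit] b p(1) a carrier_P by (auto simp: bij_betw_def inj_on_def)
    thus "b = a"
      using \<epsilon> by (simp add: inj_eq)
  qed
qed

section \<open>Coinduced modules and Peirce columns\<close>

text \<open>
  For \<open>h\<close> additive and multiplicative, \<open>f = h 1\<close> is an idempotent and this is \<open>f X\<close>, on which \<open>S\<close>
  acts through \<open>h\<close>.  If \<open>h\<close> is an isomorphism from \<open>S\<close> onto the corner \<open>f R f\<close>, it is the usual
  restriction of an \<open>R\<close>-module to that corner.
\<close>

definition corner_module ::
  "('s, 'z) ring_scheme \<Rightarrow> ('s \<Rightarrow> 'r) \<Rightarrow> ('r, 'm, 'y) module_scheme \<Rightarrow> ('s, 'm) module" where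
  "corner_module S h X = \<lparr>carrier = {x \<in> carrier X. h \<one>\<^bsub>S\<^esub> \<odot>\<^bsub>X\<^esub> x = x},
     monoid.mult = undefined, one = undefined, ring.zero = \<zero>\<^bsub>X\<^esub>, add = add X,
     smult = (\<lambda>s x. h s \<odot>\<^bsub>X\<^esub> x)\<rparr>"

lemma corner_module_simps [simp]:
  "carrier (corner_module S h X) = {x \<in> carrier X. h \<one>\<^bsub>S\<^esub> \<odot>\<^bsub>X\<^esub> x = x}"
  "add (corner_module S h X) = add X" "ring.zero (corner_module S h X) = ring.zero X"
  "s \<odot>\<^bsub>corner_module S h X\<^esub> x = h s \<odot>\<^bsub>X\<^esub> x"
  by (simp_all add: corner_module_def)

lemma corner_module_hom:
  assumes "F \<in> module_hom R X Y" "h \<in> carrier S \<rightarrow> carrier R" "\<one>\<^bsub>S\<^esub> \<in> carrier S"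
  shows "F \<in> module_hom S (corner_module S h X) (corner_module S h Y)"
proof (rule module_homI)
  fix x assume "x \<in> carrier (corner_module S h X)"
  hence x: "x \<in> carrier X" "h \<one>\<^bsub>S\<^esub> \<odot>\<^bsub>X\<^esub> x = x"
    by auto
  have "h \<one>\<^bsub>S\<^esub> \<odot>\<^bsub>Y\<^esub> F x = F (h \<one>\<^bsub>S\<^esub> \<odot>\<^bsub>X\<^esub> x)"
    by (rule module_hom_smult[OF assms(1) funcset_mem[OF assms(2,3)] x(1), symmetric])
  thus "F x \<in> carrier (corner_module S h Y)"
    using x module_hom_closed[OF assms(1)] by simp
qed (use assms(2) in \<open>auto simp: module_hom_add[OF assms(1)] module_hom_smult[OF assms(1)] Pi_iff\<close>)

locale corner_map = R: ring R + S: ring S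
  for R :: "('r, 'x) ring_scheme" and S :: "('s, 'z) ring_scheme" and h :: "'s \<Rightarrow> 'r" +
  assumes h_closed: "h \<in> carrier S \<rightarrow> carrier R"
    and h_add: "\<lbrakk>s \<in> carrier S; t \<in> carrier S\<rbrakk> \<Longrightarrow> h (s \<oplus>\<^bsub>S\<^esub> t) = h s \<oplus>\<^bsub>R\<^esub> h t"
    and h_mult: "\<lbrakk>s \<in> carrier S; t \<in> carrier S\<rbrakk> \<Longrightarrow> h (s \<otimes>\<^bsub>S\<^esub> t) = h s \<otimes>\<^bsub>R\<^esub> h t"
begin

abbreviation f :: 'r where "f \<equiv> h \<one>\<^bsub>S\<^esub>"
abbreviation corner :: "('r, 'm, 'y) module_scheme \<Rightarrow> ('s, 'm) module"
  where "corner X \<equiv> corner_module S h X"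

lemma h_in: "s \<in> carrier S \<Longrightarrow> h s \<in> carrier R"
  using h_closed by blast

lemma f_h: "s \<in> carrier S \<Longrightarrow> f \<otimes>\<^bsub>R\<^esub> h s = h s"
  by (simp flip: h_mult)

lemma h_f: "s \<in> carrier S \<Longrightarrow> h s \<otimes>\<^bsub>R\<^esub> f = h s"
  by (simp flip: h_mult)

lemma left_module_corner:
  assumes "left_module R X" shows "left_module S (corner X)"
proof -
  interpret X: left_module R X by fact
  note rules = h_in f_h X.smult_l_distr X.smult_r_distr X.smult_assoc[symmetric] X.smult_closed
    X.smult_zero_right h_add h_mult
  show ?thesis
  proof (rule left_moduleI)
    have "\<exists>y\<in>carrier (corner X). y \<oplus>\<^bsub>corner X\<^esub> x = \<zero>\<^bsub>corner X\<^esub>" if "x \<in> carrier (corner X)" for x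
      using that by (intro bexI[of _ "\<ominus>\<^bsub>X\<^esub> x"]) (auto simp: X.M.l_neg X.smult_a_inv h_in)
    thus "abelian_group (corner X)"
      by (intro abelian_groupI) (auto simp: rules X.M.a_assoc X.M.a_comm X.M.a_lcomm)
  qed (auto simp: rules S.ring_axioms)
qed

text \<open>
  The hypothesis \<open>coind\<close> says that \<open>C\<close> is coinduced from \<open>f C\<close>: evaluation identifies \<open>C\<close> with the
  \<open>S\<close>-linear maps from \<open>f R\<close> to \<open>f C\<close>.  Since coinduction is right adjoint to \<open>X \<mapsto> f X\<close>, which
  preserves injective maps, it preserves injectivity.  The proof spells the adjunction out: a map
  into \<open>C\<close> is restricted to the corner, extended there to \<open>g\<close>, and \<open>y\<close> is sent to the element of
  \<open>C\<close> that represents \<open>t \<mapsto> g (t y)\<close>.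
\<close>

lemma coinduced_injective:
  fixes C :: "('r, 'c, 'y) module_scheme"
  assumes C: "left_module R C" and inj: "injective_module TYPE('w) S (corner C)"
    and coind: "\<And>\<xi>. \<xi> \<in> module_hom S (corner (regular R)) (corner C)
      \<Longrightarrow> \<exists>!c. c \<in> carrier C \<and> (\<forall>t\<in>carrier (corner (regular R)). t \<odot>\<^bsub>C\<^esub> c = \<xi> t)"
  shows "injective_module TYPE('w) R C"
proof (rule injective_moduleI[OF C])
  fix X Y :: "('r, 'w) module" and i F
  assume X: "left_module R X" and Y: "left_module R Y" and i: "i \<in> module_hom R X Y"
    and inj_i: "inj_on i (carrier X)" and F: "F \<in> module_hom R X C"
  interpret X: left_module R X by fact
  interpret Y: left_module R Y by fact
  interpret C: left_module R C by fact
  let ?fR = "carrier (corner (regular R))"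
  obtain g where g: "g \<in> module_hom S (corner Y) (corner C)"
    and gi: "\<And>x. x \<in> carrier (corner X) \<Longrightarrow> g (i x) = F x"
  proof (rule injective_module_extend[OF inj left_module_corner[OF X] left_module_corner[OF Y]])
    show "i \<in> module_hom S (corner X) (corner Y)" "F \<in> module_hom S (corner X) (corner C)"
      by (rule corner_module_hom[OF i h_closed], simp) (rule corner_module_hom[OF F h_closed], simp)
    show "inj_on i (carrier (corner X))"
      using inj_i by (rule inj_on_subset) auto
  qed (rule that)
  have fR: "t \<in> carrier R" "f \<otimes>\<^bsub>R\<^esub> t = t" if "t \<in> ?fR" for t
    using that by auto
  have fR_smult: "t \<odot>\<^bsub>Z\<^esub> z \<in> carrier (corner Z)" if "left_module R Z" "t \<in> ?fR" "z \<in> carrier Z"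
    for Z :: "('r, 'w) module" and t z
  proof -
    interpret Z: left_module R Z by fact
    show ?thesis
      using fR[OF that(2)] that(3) h_in[of "\<one>\<^bsub>S\<^esub>"]
      by (simp add: Z.smult_closed flip: Z.smult_assoc)
  qed
  have fR_mult: "t \<otimes>\<^bsub>R\<^esub> r \<in> ?fR" if "t \<in> ?fR" "r \<in> carrier R" for t r
    using fR[OF that(1)] that(2) h_in[of "\<one>\<^bsub>S\<^esub>"] by (simp flip: R.m_assoc)
  define G where "G y = (THE c. c \<in> carrier C \<and> (\<forall>t\<in>?fR. t \<odot>\<^bsub>C\<^esub> c = g (t \<odot>\<^bsub>Y\<^esub> y)))" for y
  have ex1: "\<exists>!c. c \<in> carrier C \<and> (\<forall>t\<in>?fR. t \<odot>\<^bsub>C\<^esub> c = g (t \<odot>\<^bsub>Y\<^esub> y))" if y: "y \<in> carrier Y" for y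
  proof (rule coind)
    show "(\<lambda>t. g (t \<odot>\<^bsub>Y\<^esub> y)) \<in> module_hom S (corner (regular R)) (corner C)"
    proof (rule module_homI)
      fix t assume t: "t \<in> ?fR"
      show "g (t \<odot>\<^bsub>Y\<^esub> y) \<in> carrier (corner C)"
        by (rule module_hom_closed[OF g fR_smult[OF Y t y]])
      show "g ((s \<odot>\<^bsub>corner (regular R)\<^esub> t) \<odot>\<^bsub>Y\<^esub> y) = s \<odot>\<^bsub>corner C\<^esub> g (t \<odot>\<^bsub>Y\<^esub> y)"
        if "s \<in> carrier S" for s
        using module_hom_smult[OF g that fR_smult[OF Y t y]] fR(1)[OF t] y h_in[OF that]
        by (simp add: Y.smult_assoc)
      fix u assume u: "u \<in> ?fR"
      show "g ((t \<oplus>\<^bsub>corner (regular R)\<^esub> u) \<odot>\<^bsub>Y\<^esub> y) = g (t \<odot>\<^bsub>Y\<^esub> y) \<oplus>\<^bsub>corner C\<^esub> g (u \<odot>\<^bsub>Y\<^esub> y)"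
        using module_hom_add[OF g fR_smult[OF Y t y] fR_smult[OF Y u y]] fR(1)[OF t] fR(1)[OF u] y
        by (simp add: Y.smult_l_distr)
    qed
  qed
  have G_closed: "G y \<in> carrier C" and G: "\<And>t. t \<in> ?fR \<Longrightarrow> t \<odot>\<^bsub>C\<^esub> G y = g (t \<odot>\<^bsub>Y\<^esub> y)"
    if "y \<in> carrier Y" for y
    using theI'[OF ex1[OF that]] unfolding G_def by blast+
  have G_eq: "G y = c" if "y \<in> carrier Y" "c \<in> carrier C" "\<And>t. t \<in> ?fR \<Longrightarrow> t \<odot>\<^bsub>C\<^esub> c = g (t \<odot>\<^bsub>Y\<^esub> y)" for y c
    unfolding G_def by (rule the1_equality[OF ex1[OF that(1)]]) (use that(2,3) in blast)
  have "G \<in> module_hom R Y C"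
  proof (rule module_homI)
    fix y assume y: "y \<in> carrier Y"
    show "G y \<in> carrier C" by (rule G_closed[OF y])
    show "G (r \<odot>\<^bsub>Y\<^esub> y) = r \<odot>\<^bsub>C\<^esub> G y" if r: "r \<in> carrier R" for r
    proof (rule G_eq)
      fix t assume t: "t \<in> ?fR"
      show "t \<odot>\<^bsub>C\<^esub> (r \<odot>\<^bsub>C\<^esub> G y) = g (t \<odot>\<^bsub>Y\<^esub> (r \<odot>\<^bsub>Y\<^esub> y))"
        using G[OF y fR_mult[OF t r]] fR(1)[OF t] r y G_closed[OF y]
        by (simp add: C.smult_assoc Y.smult_assoc)
    qed (use r y G_closed[OF y] in \<open>auto simp: C.smult_closed Y.smult_closed\<close>)
    fix z assume z: "z \<in> carrier Y"
    show "G (y \<oplus>\<^bsub>Y\<^esub> z) = G y \<oplus>\<^bsub>C\<^esub> G z"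
    proof (rule G_eq)
      fix t assume t: "t \<in> ?fR"
      show "t \<odot>\<^bsub>C\<^esub> (G y \<oplus>\<^bsub>C\<^esub> G z) = g (t \<odot>\<^bsub>Y\<^esub> (y \<oplus>\<^bsub>Y\<^esub> z))"
        using G[OF y t] G[OF z t] fR(1)[OF t] y z G_closed[OF y] G_closed[OF z]
          module_hom_add[OF g fR_smult[OF Y t y] fR_smult[OF Y t z]]
        by (simp add: C.smult_r_distr Y.smult_r_distr)
    qed (use y z G_closed in auto)
  qed
  moreover have "G (i x) = F x" if x: "x \<in> carrier X" for x
  proof (rule G_eq)
    fix t assume t: "t \<in> ?fR"
    show "t \<odot>\<^bsub>C\<^esub> F x = g (t \<odot>\<^bsub>Y\<^esub> i x)"
      using gi[OF fR_smult[OF X t x]] fR(1)[OF t] x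
      by (simp add: module_hom_smult[OF i] module_hom_smult[OF F])
  qed (use x module_hom_closed[OF i] module_hom_closed[OF F] in auto)
  ultimately show "\<exists>G\<in>module_hom R Y C. \<forall>x\<in>carrier X. G (i x) = F x"
    by (intro bexI[of _ G]) auto
qed

end

text \<open>
  For an idempotent \<open>e\<close> this is the left ideal \<open>R e\<close>.
\<close>

definition column :: "('r, 'x) ring_scheme \<Rightarrow> 'r \<Rightarrow> ('r, 'r, 'r) bimodule" where
  "column R e = (regular R)\<lparr>carrier := {r \<in> carrier R. r \<otimes>\<^bsub>R\<^esub> e = r}\<rparr>"

lemma column_simps [simp]:
  "carrier (column R e) = {r \<in> carrier R. r \<otimes>\<^bsub>R\<^esub> e = r}" "add (column R e) = add R"
  "ring.zero (column R e) = ring.zero R" "smult (column R e) = monoid.mult R"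
  by (simp_all add: column_def)

lemma (in ring) left_module_column:
  assumes "e \<in> carrier R" shows "left_module R (column R e)"
  unfolding column_def
  by (rule left_module.left_module_carrier_update[OF left_module_regular])
     (use assms in \<open>auto simp: l_distr m_assoc\<close>)

text \<open>
  \<open>R\<close> is the direct sum of its two columns, so a map into \<open>R\<close> can be extended column by column.
\<close>

lemma (in ring) regular_injective_from_columns:
  assumes e: "e \<in> carrier R" "e \<otimes> e = e" and f: "f \<in> carrier R" "f \<otimes> f = f" and sum: "e \<oplus> f = \<one>"
    and inj: "injective_module TYPE('w) R (column R e)" "injective_module TYPE('w) R (column R f)"
  shows "injective_module TYPE('w) R (regular R)"
proof (rule injective_moduleI[OF left_module_regular])
  fix X Y :: "('a, 'w) module" and i F
  assume X: "left_module R X" and Y: "left_module R Y" and i: "i \<in> module_hom R X Y"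
    and inj_i: "inj_on i (carrier X)" and F: "F \<in> module_hom R X (regular R)"
  have proj: "(\<lambda>x. F x \<otimes> u) \<in> module_hom R X (column R u)" if "u \<in> carrier R" "u \<otimes> u = u" for u
    using module_homD[OF F] that by (intro module_homI) (auto simp: m_assoc l_distr)
  obtain G1 where G1: "G1 \<in> module_hom R Y (column R e)" "\<And>x. x \<in> carrier X \<Longrightarrow> G1 (i x) = F x \<otimes> e"
    by (rule injective_module_extend[OF inj(1) X Y i inj_i proj[OF e]]) (rule that)
  obtain G2 where G2: "G2 \<in> module_hom R Y (column R f)" "\<And>x. x \<in> carrier X \<Longrightarrow> G2 (i x) = F x \<otimes> f"
    by (rule injective_module_extend[OF inj(2) X Y i inj_i proj[OF f]]) (rule that)
  have "(\<lambda>y. G1 y \<oplus> G2 y) \<in> module_hom R Y (regular R)"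
    using module_homD[OF G1(1)] module_homD[OF G2(1)]
    by (intro module_homI) (auto simp: r_distr a_assoc a_lcomm)
  moreover have "G1 (i x) \<oplus> G2 (i x) = F x" if "x \<in> carrier X" for x
    using module_hom_closed[OF F that] G1(2)[OF that] G2(2)[OF that] sum e(1) f(1)
    by (simp flip: r_distr)
  ultimately show "\<exists>g\<in>module_hom R Y (regular R). \<forall>x\<in>carrier X. g (i x) = F x"
    by (intro bexI[of _ "\<lambda>y. G1 y \<oplus> G2 y"]) auto
qed

text \<open>
  The Peirce decomposition with respect to \<open>e\<close> and \<open>f\<close> shows that the column \<open>R e\<close> is coinduced
  from its part \<open>f R e\<close>, for which \<open>D\<close> is a model.  Indeed \<open>f R\<close> is the sum of \<open>f R e\<close> and \<open>f R f\<close>.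
  On \<open>f R f\<close>, the image of \<open>h\<close>, a linear map \<open>\<xi>\<close> is right multiplication by \<open>\<xi> f\<close>; on \<open>f R e\<close> it is
  an endomorphism of \<open>D\<close>, which by \<open>endo\<close> is right multiplication by an element of \<open>e R e\<close>.
\<close>

lemma (in corner_map) column_injective:
  fixes D :: "('s, 'd, 'v) module_scheme"
  assumes e: "e \<in> carrier R" and sum: "e \<oplus>\<^bsub>R\<^esub> f = \<one>\<^bsub>R\<^esub>"
    and ef: "e \<otimes>\<^bsub>R\<^esub> f = \<zero>\<^bsub>R\<^esub>" and fe: "f \<otimes>\<^bsub>R\<^esub> e = \<zero>\<^bsub>R\<^esub>"
    and h_onto: "\<And>r. r \<in> carrier R \<Longrightarrow> \<exists>s\<in>carrier S. h s = f \<otimes>\<^bsub>R\<^esub> r \<otimes>\<^bsub>R\<^esub> f"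
    and D: "injective_module TYPE('w) S D"
    and \<delta>: "\<delta> \<in> module_iso S D (corner (column R e))"
    and endo: "\<And>\<theta>. \<theta> \<in> module_hom S D D \<Longrightarrow>
      \<exists>!a. a \<in> carrier R \<and> e \<otimes>\<^bsub>R\<^esub> a = a \<and> a \<otimes>\<^bsub>R\<^esub> e = a \<and> (\<forall>d\<in>carrier D. \<delta> (\<theta> d) = \<delta> d \<otimes>\<^bsub>R\<^esub> a)"
  shows "injective_module TYPE('w) R (column R e)"
proof (rule coinduced_injective[OF R.left_module_column[OF e]])
  have Dmod: "left_module S D"
    using D by (simp add: injective_module_def)
  have colmod: "left_module S (corner (column R e))"
    by (rule left_module_corner[OF R.left_module_column[OF e]])
  have \<delta>_hom: "\<delta> \<in> module_hom S D (corner (column R e))"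
    and \<delta>_bij: "bij_betw \<delta> (carrier D) (carrier (corner (column R e)))"
    by (rule module_isoD[OF \<delta>])+
  let ?\<rho> = "inv_into (carrier D) \<delta>"
  have \<rho>_hom: "?\<rho> \<in> module_hom S (corner (column R e)) D"
    by (rule module_iso_inv[OF \<delta> Dmod])
  have \<delta>\<rho>: "\<delta> (?\<rho> x) = x" if "x \<in> carrier (corner (column R e))" for x
    using \<delta>_bij that by (rule bij_betw_inv_into_right)
  show "injective_module TYPE('w) S (corner (column R e))"
    by (rule injective_module_retract[OF D colmod \<rho>_hom \<delta>_hom \<delta>\<rho>])
  have f: "f \<in> carrier R" "f \<otimes>\<^bsub>R\<^esub> f = f"
    using h_in f_h by auto
  have \<delta>_in: "\<delta> d \<in> carrier R" "f \<otimes>\<^bsub>R\<^esub> \<delta> d = \<delta> d" "\<delta> d \<otimes>\<^bsub>R\<^esub> e = \<delta> d" if "d \<in> carrier D" for d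
    using module_hom_closed[OF \<delta>_hom that] by auto
  have ee: "e \<otimes>\<^bsub>R\<^esub> e = e"
    using sum e f(1) ef by (metis R.m_closed R.r_distr R.r_one R.r_zero)
  let ?fR = "carrier (corner (regular R))"
  fix \<xi> assume \<xi>: "\<xi> \<in> module_hom S (corner (regular R)) (corner (column R e))"
  have \<delta>_fR: "\<delta> d \<in> ?fR" if "d \<in> carrier D" for d
    using \<delta>_in[OF that] by simp
  have f_fR: "f \<in> ?fR" using f by simp
  have \<xi>_in: "\<xi> t \<in> carrier R" "f \<otimes>\<^bsub>R\<^esub> \<xi> t = \<xi> t" "\<xi> t \<otimes>\<^bsub>R\<^esub> e = \<xi> t" if "t \<in> ?fR" for t
    using module_hom_closed[OF \<xi> that] by auto
  have e_killed: "e \<otimes>\<^bsub>R\<^esub> x = \<zero>\<^bsub>R\<^esub>" if "x \<in> carrier R" "f \<otimes>\<^bsub>R\<^esub> x = x" for x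
    using that e f(1) ef by (metis R.l_null R.m_assoc)
  have "(\<lambda>d. ?\<rho> (\<xi> (\<delta> d))) \<in> module_hom S D D"
    using \<delta>_fR
    by (intro module_hom_comp[OF module_hom_comp[OF _ \<xi>] \<rho>_hom] module_homI)
       (auto simp: module_hom_add[OF \<delta>_hom] module_hom_smult[OF \<delta>_hom])
  from endo[OF this] obtain a where
      "a \<in> carrier R \<and> e \<otimes>\<^bsub>R\<^esub> a = a \<and> a \<otimes>\<^bsub>R\<^esub> e = a \<and>
        (\<forall>d\<in>carrier D. \<delta> (?\<rho> (\<xi> (\<delta> d))) = \<delta> d \<otimes>\<^bsub>R\<^esub> a)"
      and a_uniq': "\<forall>b. b \<in> carrier R \<and> e \<otimes>\<^bsub>R\<^esub> b = b \<and> b \<otimes>\<^bsub>R\<^esub> e = b \<and>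
        (\<forall>d\<in>carrier D. \<delta> (?\<rho> (\<xi> (\<delta> d))) = \<delta> d \<otimes>\<^bsub>R\<^esub> b) \<longrightarrow> b = a"
    by (rule ex1E) (rule that)
  moreover have \<delta>\<rho>\<xi>\<delta>: "\<delta> (?\<rho> (\<xi> (\<delta> d))) = \<xi> (\<delta> d)" if "d \<in> carrier D" for d
    by (rule \<delta>\<rho>[OF module_hom_closed[OF \<xi> \<delta>_fR[OF that]]])
  ultimately have a: "a \<in> carrier R" "e \<otimes>\<^bsub>R\<^esub> a = a" "a \<otimes>\<^bsub>R\<^esub> e = a"
      and \<xi>a: "\<And>d. d \<in> carrier D \<Longrightarrow> \<xi> (\<delta> d) = \<delta> d \<otimes>\<^bsub>R\<^esub> a"
    by simp_all
  have a_uniq: "b = a" if "b \<in> carrier R" "e \<otimes>\<^bsub>R\<^esub> b = b" "b \<otimes>\<^bsub>R\<^esub> e = b"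
      "\<And>d. d \<in> carrier D \<Longrightarrow> \<xi> (\<delta> d) = \<delta> d \<otimes>\<^bsub>R\<^esub> b" for b
  proof (rule a_uniq'[rule_format], intro conjI ballI that(1-3))
    fix d assume "d \<in> carrier D"
    thus "\<delta> (?\<rho> (\<xi> (\<delta> d))) = \<delta> d \<otimes>\<^bsub>R\<^esub> b"
      using that(4) \<delta>\<rho>\<xi>\<delta> by metis
  qed
  have fa: "f \<otimes>\<^bsub>R\<^esub> a = \<zero>\<^bsub>R\<^esub>"
    using a e f(1) fe by (metis R.l_null R.m_assoc)
  \<comment> \<open>The two summands are the components \<open>e c\<close> and \<open>f c\<close> of the element \<open>c\<close> that represents \<open>\<xi>\<close>.\<close>
  show "\<exists>!c. c \<in> carrier (column R e) \<and> (\<forall>t\<in>?fR. t \<odot>\<^bsub>column R e\<^esub> c = \<xi> t)"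
  proof (intro ex1I[of _ "a \<oplus>\<^bsub>R\<^esub> \<xi> f"] conjI ballI)
    show "a \<oplus>\<^bsub>R\<^esub> \<xi> f \<in> carrier (column R e)"
      using a \<xi>_in[OF f_fR] e by (simp add: R.l_distr)
    fix t assume t: "t \<in> ?fR"
    hence tR: "t \<in> carrier R" "f \<otimes>\<^bsub>R\<^esub> t = t" by auto
    have "t \<otimes>\<^bsub>R\<^esub> e \<in> carrier (corner (column R e))"
      using tR e f(1) ee by (simp add: R.m_assoc flip: R.m_assoc[of f t e])
    then obtain d where d: "d \<in> carrier D" "\<delta> d = t \<otimes>\<^bsub>R\<^esub> e"
      using \<delta>_bij unfolding bij_betw_def by (metis imageE)
    obtain s where s: "s \<in> carrier S" "h s = t \<otimes>\<^bsub>R\<^esub> f"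
      using h_onto[OF tR(1)] tR(2) by auto
    have t_split: "t = \<delta> d \<oplus>\<^bsub>R\<^esub> h s"
      using d(2) s(2) tR(1) e f(1) sum by (simp flip: R.r_distr)
    have 1: "\<delta> d \<otimes>\<^bsub>R\<^esub> (a \<oplus>\<^bsub>R\<^esub> \<xi> f) = \<xi> (\<delta> d)"
    proof -
      have "\<delta> d \<otimes>\<^bsub>R\<^esub> \<xi> f = \<delta> d \<otimes>\<^bsub>R\<^esub> (e \<otimes>\<^bsub>R\<^esub> \<xi> f)"
        using \<delta>_in[OF d(1)] \<xi>_in[OF f_fR] e by (simp flip: R.m_assoc)
      thus ?thesis
        using \<delta>_in[OF d(1)] \<xi>_in[OF f_fR] a(1) \<xi>a[OF d(1)] e_killed[of "\<xi> f"] by (simp add: R.r_distr)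
    qed
    have 2: "h s \<otimes>\<^bsub>R\<^esub> (a \<oplus>\<^bsub>R\<^esub> \<xi> f) = \<xi> (h s)"
    proof -
      have "h s \<otimes>\<^bsub>R\<^esub> a = h s \<otimes>\<^bsub>R\<^esub> (f \<otimes>\<^bsub>R\<^esub> a)"
        using h_in[OF s(1)] h_f[OF s(1)] f(1) a(1) by (simp flip: R.m_assoc)
      moreover have "h s \<otimes>\<^bsub>R\<^esub> \<xi> f = \<xi> (h s)"
        using module_hom_smult[OF \<xi> s(1) f_fR] h_f[OF s(1)] by simp
      ultimately show ?thesis
        using h_in[OF s(1)] f_h[OF s(1)] \<xi>_in(1)[of "h s"] \<xi>_in[OF f_fR] a(1) fa by (simp add: R.r_distr)
    qed
    have "\<xi> t = \<xi> (\<delta> d) \<oplus>\<^bsub>R\<^esub> \<xi> (h s)"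
      using module_hom_add[OF \<xi> \<delta>_fR[OF d(1)], of "h s"] h_in[OF s(1)] f_h[OF s(1)] t_split by simp
    thus "t \<odot>\<^bsub>column R e\<^esub> (a \<oplus>\<^bsub>R\<^esub> \<xi> f) = \<xi> t"
      using 1 2 t_split \<delta>_in[OF d(1)] h_in[OF s(1)] a(1) \<xi>_in[OF f_fR] by (simp add: R.l_distr)
  next
    fix c assume c: "c \<in> carrier (column R e) \<and> (\<forall>t\<in>?fR. t \<odot>\<^bsub>column R e\<^esub> c = \<xi> t)"
    hence cR: "c \<in> carrier R" "c \<otimes>\<^bsub>R\<^esub> e = c" and ct: "\<And>t. t \<in> ?fR \<Longrightarrow> t \<otimes>\<^bsub>R\<^esub> c = \<xi> t"
      by auto
    have "e \<otimes>\<^bsub>R\<^esub> c = a"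
    proof (rule a_uniq)
      fix d assume d: "d \<in> carrier D"
      show "\<xi> (\<delta> d) = \<delta> d \<otimes>\<^bsub>R\<^esub> (e \<otimes>\<^bsub>R\<^esub> c)"
        using ct[OF \<delta>_fR[OF d]] \<delta>_in[OF d] cR(1) e by (simp flip: R.m_assoc)
    qed (use cR e ee in \<open>simp_all add: R.m_assoc flip: R.m_assoc[of e e c]\<close>)
    moreover have "c = e \<otimes>\<^bsub>R\<^esub> c \<oplus>\<^bsub>R\<^esub> f \<otimes>\<^bsub>R\<^esub> c"
      using cR(1) e f(1) sum by (simp flip: R.l_distr)
    ultimately show "c = a \<oplus>\<^bsub>R\<^esub> \<xi> f"
      using ct[OF f_fR] by simp
  qed
qed

section \<open>Morita rings\<close>

context tensor_product
begin

lemma additive_on_tensor_zero: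
  assumes "abelian_group X" "\<And>t. t \<in> carrier T \<Longrightarrow> \<phi> t \<in> carrier X"
    and "\<And>t u. \<lbrakk>t \<in> carrier T; u \<in> carrier T\<rbrakk> \<Longrightarrow> \<phi> (t \<oplus>\<^bsub>T\<^esub> u) = \<phi> t \<oplus>\<^bsub>X\<^esub> \<phi> u"
  shows "p \<in> carrier P \<Longrightarrow> \<phi> (\<zero>\<^bsub>M\<^esub> \<otimes>t p) = \<zero>\<^bsub>X\<^esub>" "m \<in> carrier M \<Longrightarrow> \<phi> (m \<otimes>t \<zero>\<^bsub>P\<^esub>) = \<zero>\<^bsub>X\<^esub>"
proof -
  interpret X: abelian_group X by fact
  have double: "\<phi> t = \<zero>\<^bsub>X\<^esub>" if "t \<in> carrier T" "t \<oplus>\<^bsub>T\<^esub> t = t" for t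
    using assms(2)[OF that(1)] assms(3)[OF that(1,1)] that(2) X.add.l_cancel_one by metis
  show "\<phi> (\<zero>\<^bsub>M\<^esub> \<otimes>t p) = \<zero>\<^bsub>X\<^esub>" if "p \<in> carrier P"
    using that by (intro double) (simp_all add: pure_closed flip: pure_add_left)
  show "\<phi> (m \<otimes>t \<zero>\<^bsub>P\<^esub>) = \<zero>\<^bsub>X\<^esub>" if "m \<in> carrier M"
    using that by (intro double) (simp_all add: pure_closed flip: pure_add_right)
qed

end

lemma bimodule_hom_tensor:
  assumes \<phi>: "\<phi> \<in> bimodule_hom R T (tensor_bimodule S M N) (regular R)"
    and M: "bimodule R S M" and N: "left_module S N"
  shows tensor_map_closed: "\<lbrakk>m \<in> carrier M; n \<in> carrier N\<rbrakk> \<Longrightarrow> \<phi> (pure_tensor S M N m n) \<in> carrier R"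
    and tensor_map_zero_left: "n \<in> carrier N \<Longrightarrow> \<phi> (pure_tensor S M N \<zero>\<^bsub>M\<^esub> n) = \<zero>\<^bsub>R\<^esub>"
    and tensor_map_zero_right: "m \<in> carrier M \<Longrightarrow> \<phi> (pure_tensor S M N m \<zero>\<^bsub>N\<^esub>) = \<zero>\<^bsub>R\<^esub>"
proof -
  interpret tensor_product R S M N
    using M N by (simp add: tensor_product_def)
  have \<phi>': "\<phi> \<in> module_hom R (tensor_bimodule S M N) (regular R)"
    using \<phi> by (simp add: bimodule_hom_def)
  have closed: "\<phi> t \<in> carrier R" if "t \<in> carrier (tensor_group S M N)" for t
    using module_hom_closed[OF \<phi>', of t] that by (simp add: tensor_bimodule_def Let_def)
  have add: "\<phi> (t \<oplus>\<^bsub>tensor_group S M N\<^esub> u) = \<phi> t \<oplus>\<^bsub>R\<^esub> \<phi> u"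
    if "t \<in> carrier (tensor_group S M N)" "u \<in> carrier (tensor_group S M N)" for t u
    using module_hom_add[OF \<phi>', of t u] that by (simp add: tensor_bimodule_def Let_def)
  show "\<lbrakk>m \<in> carrier M; n \<in> carrier N\<rbrakk> \<Longrightarrow> \<phi> (pure_tensor S M N m n) \<in> carrier R"
    by (rule closed[OF pure_closed])
  show "n \<in> carrier N \<Longrightarrow> \<phi> (pure_tensor S M N \<zero>\<^bsub>M\<^esub> n) = \<zero>\<^bsub>R\<^esub>"
    "m \<in> carrier M \<Longrightarrow> \<phi> (pure_tensor S M N m \<zero>\<^bsub>N\<^esub>) = \<zero>\<^bsub>R\<^esub>"
    using additive_on_tensor_zero[OF M.R.abelian_group_axioms closed add] by auto
qed

context bimodule
begin

lemma rsmult_zero_right: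
  assumes "x \<in> carrier M" shows "x \<triangleleft>\<^bsub>M\<^esub> \<zero>\<^bsub>S\<^esub> = \<zero>\<^bsub>M\<^esub>"
proof -
  have "x \<triangleleft>\<^bsub>M\<^esub> \<zero>\<^bsub>S\<^esub> \<oplus>\<^bsub>M\<^esub> x \<triangleleft>\<^bsub>M\<^esub> \<zero>\<^bsub>S\<^esub> = x \<triangleleft>\<^bsub>M\<^esub> \<zero>\<^bsub>S\<^esub>"
    using assms by (simp flip: rsmult_r_distr)
  thus ?thesis
    using assms M.add.r_cancel_one rsmult_closed by blast
qed

lemma rsmult_zero_left:
  assumes "s \<in> carrier S" shows "\<zero>\<^bsub>M\<^esub> \<triangleleft>\<^bsub>M\<^esub> s = \<zero>\<^bsub>M\<^esub>"
proof -
  have "\<zero>\<^bsub>M\<^esub> \<triangleleft>\<^bsub>M\<^esub> s \<oplus>\<^bsub>M\<^esub> \<zero>\<^bsub>M\<^esub> \<triangleleft>\<^bsub>M\<^esub> s = \<zero>\<^bsub>M\<^esub> \<triangleleft>\<^bsub>M\<^esub> s"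
    using assms by (simp flip: rsmult_l_distr)
  thus ?thesis
    using assms M.add.r_cancel_one rsmult_closed by blast
qed

end

lemma morita_ring_simps:
  "carrier (morita_ring A B N M \<phi> \<psi>) = carrier A \<times> carrier N \<times> carrier M \<times> carrier B"
  "\<one>\<^bsub>morita_ring A B N M \<phi> \<psi>\<^esub> = (\<one>\<^bsub>A\<^esub>, \<zero>\<^bsub>N\<^esub>, \<zero>\<^bsub>M\<^esub>, \<one>\<^bsub>B\<^esub>)"
  "\<zero>\<^bsub>morita_ring A B N M \<phi> \<psi>\<^esub> = (\<zero>\<^bsub>A\<^esub>, \<zero>\<^bsub>N\<^esub>, \<zero>\<^bsub>M\<^esub>, \<zero>\<^bsub>B\<^esub>)"
  "(a, n, m, b) \<oplus>\<^bsub>morita_ring A B N M \<phi> \<psi>\<^esub> (a', n', m', b') =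
     (a \<oplus>\<^bsub>A\<^esub> a', n \<oplus>\<^bsub>N\<^esub> n', m \<oplus>\<^bsub>M\<^esub> m', b \<oplus>\<^bsub>B\<^esub> b')"
  "(a, n, m, b) \<otimes>\<^bsub>morita_ring A B N M \<phi> \<psi>\<^esub> (a', n', m', b') =
     (a \<otimes>\<^bsub>A\<^esub> a' \<oplus>\<^bsub>A\<^esub> \<psi> (pure_tensor B N M n m'),
      a \<odot>\<^bsub>N\<^esub> n' \<oplus>\<^bsub>N\<^esub> n \<triangleleft>\<^bsub>N\<^esub> b',
      m \<triangleleft>\<^bsub>M\<^esub> a' \<oplus>\<^bsub>M\<^esub> b \<odot>\<^bsub>M\<^esub> m',
      b \<otimes>\<^bsub>B\<^esub> b' \<oplus>\<^bsub>B\<^esub> \<phi> (pure_tensor A M N m n'))"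
  by (simp_all add: morita_ring_def)

locale morita_ring_is_ring = morita_data A B N M \<phi> \<psi> + \<Lambda>: ring "morita_ring A B N M \<phi> \<psi>"
  for A :: "'a ring" and B :: "'b ring"
    and N :: "('a, 'b, 'n) bimodule" and M :: "('b, 'a, 'm) bimodule"
    and \<phi> :: "('m \<times> 'n \<Rightarrow>\<^sub>0 int) set \<Rightarrow> 'b" and \<psi> :: "('n \<times> 'm \<Rightarrow>\<^sub>0 int) set \<Rightarrow> 'a"
begin

abbreviation "\<Lambda> \<equiv> morita_ring A B N M \<phi> \<psi>"
abbreviation "e\<^sub>A \<equiv> (\<one>\<^bsub>A\<^esub>, \<zero>\<^bsub>N\<^esub>, \<zero>\<^bsub>M\<^esub>, \<zero>\<^bsub>B\<^esub>)"
abbreviation "e\<^sub>B \<equiv> (\<zero>\<^bsub>A\<^esub>, \<zero>\<^bsub>N\<^esub>, \<zero>\<^bsub>M\<^esub>, \<one>\<^bsub>B\<^esub>)"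

lemmas entry_rules =
  N.smult_closed N.rsmult_closed M.smult_closed M.rsmult_closed
  N.smult_one N.rsmult_one M.smult_one M.rsmult_one
  N.smult_zero_left N.smult_zero_right M.smult_zero_left M.smult_zero_right
  N.rsmult_zero_left N.rsmult_zero_right M.rsmult_zero_left M.rsmult_zero_right
  bimodule_hom_tensor[OF phi_hom M.bimodule_axioms N.left_module_axioms]
  bimodule_hom_tensor[OF psi_hom N.bimodule_axioms M.left_module_axioms]

text \<open>
  The first column has \<open>A\<close> above \<open>M\<close>.  Its part in the corner \<open>B\<close> is \<open>M\<close>, and its part in the
  corner \<open>A\<close> is \<open>A\<close>, which the hypothesis identifies with the endomorphisms of \<open>M\<close>.
\<close>

lemma column_A_injective:
  assumes M_inj: "injective_module TYPE('w) B M"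
    and M_endo: "\<And>\<theta>. \<theta> \<in> module_hom B M M \<Longrightarrow>
      \<exists>!a. a \<in> carrier A \<and> (\<forall>m\<in>carrier M. \<theta> m = m \<triangleleft>\<^bsub>M\<^esub> a)"
  shows "injective_module TYPE('w) \<Lambda> (column \<Lambda> e\<^sub>A)"
proof -
  let ?h = "\<lambda>b. (\<zero>\<^bsub>A\<^esub>, \<zero>\<^bsub>N\<^esub>, \<zero>\<^bsub>M\<^esub>, b)"
  let ?\<delta> = "\<lambda>m. (\<zero>\<^bsub>A\<^esub>, \<zero>\<^bsub>N\<^esub>, m, \<zero>\<^bsub>B\<^esub>)"
  note rules = morita_ring_simps entry_rules
  interpret corner_map \<Lambda> B ?h
    by unfold_locales (auto simp: rules)
  show ?thesis
  proof (rule column_injective[OF _ _ _ _ _ M_inj, of e\<^sub>A ?\<delta>])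
    show "\<exists>b\<in>carrier B. ?h b = ?h \<one>\<^bsub>B\<^esub> \<otimes>\<^bsub>\<Lambda>\<^esub> r \<otimes>\<^bsub>\<Lambda>\<^esub> ?h \<one>\<^bsub>B\<^esub>" if "r \<in> carrier \<Lambda>" for r
      using that by (auto simp: rules)
    have "?\<delta> \<in> module_hom B M (corner (column \<Lambda> e\<^sub>A))"
      by (rule module_homI) (auto simp: rules)
    moreover have "bij_betw ?\<delta> (carrier M) (carrier (corner (column \<Lambda> e\<^sub>A)))"
      by (rule bij_betwI') (auto simp: rules)
    ultimately show "?\<delta> \<in> module_iso B M (corner (column \<Lambda> e\<^sub>A))"
      by (simp add: module_iso_def)
    fix \<theta> assume \<theta>: "\<theta> \<in> module_hom B M M"
    from M_endo[OF \<theta>] obtain a where a: "a \<in> carrier A \<and> (\<forall>m\<in>carrier M. \<theta> m = m \<triangleleft>\<^bsub>M\<^esub> a)"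
      and uniq: "\<forall>a'. a' \<in> carrier A \<and> (\<forall>m\<in>carrier M. \<theta> m = m \<triangleleft>\<^bsub>M\<^esub> a') \<longrightarrow> a' = a"
      by (rule ex1E) (rule that)
    show "\<exists>!x. x \<in> carrier \<Lambda> \<and> e\<^sub>A \<otimes>\<^bsub>\<Lambda>\<^esub> x = x \<and> x \<otimes>\<^bsub>\<Lambda>\<^esub> e\<^sub>A = x \<and>
        (\<forall>m\<in>carrier M. ?\<delta> (\<theta> m) = ?\<delta> m \<otimes>\<^bsub>\<Lambda>\<^esub> x)"
    proof (rule ex1I[of _ "(a, \<zero>\<^bsub>N\<^esub>, \<zero>\<^bsub>M\<^esub>, \<zero>\<^bsub>B\<^esub>)"])
      show "(a, \<zero>\<^bsub>N\<^esub>, \<zero>\<^bsub>M\<^esub>, \<zero>\<^bsub>B\<^esub>) \<in> carrier \<Lambda> \<and> e\<^sub>A \<otimes>\<^bsub>\<Lambda>\<^esub> (a, \<zero>\<^bsub>N\<^esub>, \<zero>\<^bsub>M\<^esub>, \<zero>\<^bsub>B\<^esub>) = (a, \<zero>\<^bsub>N\<^esub>, \<zero>\<^bsub>M\<^esub>, \<zero>\<^bsub>B\<^esub>) \<and>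
          (a, \<zero>\<^bsub>N\<^esub>, \<zero>\<^bsub>M\<^esub>, \<zero>\<^bsub>B\<^esub>) \<otimes>\<^bsub>\<Lambda>\<^esub> e\<^sub>A = (a, \<zero>\<^bsub>N\<^esub>, \<zero>\<^bsub>M\<^esub>, \<zero>\<^bsub>B\<^esub>) \<and>
          (\<forall>m\<in>carrier M. ?\<delta> (\<theta> m) = ?\<delta> m \<otimes>\<^bsub>\<Lambda>\<^esub> (a, \<zero>\<^bsub>N\<^esub>, \<zero>\<^bsub>M\<^esub>, \<zero>\<^bsub>B\<^esub>))"
        using a by (simp add: rules)
      fix x assume x: "x \<in> carrier \<Lambda> \<and> e\<^sub>A \<otimes>\<^bsub>\<Lambda>\<^esub> x = x \<and> x \<otimes>\<^bsub>\<Lambda>\<^esub> e\<^sub>A = x \<and>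
        (\<forall>m\<in>carrier M. ?\<delta> (\<theta> m) = ?\<delta> m \<otimes>\<^bsub>\<Lambda>\<^esub> x)"
      obtain a' n m b where "x = (a', n, m, b)"
        by (metis surj_pair)
      with x show "x = (a, \<zero>\<^bsub>N\<^esub>, \<zero>\<^bsub>M\<^esub>, \<zero>\<^bsub>B\<^esub>)"
        using uniq[rule_format, of a'] by (auto simp: rules)
    qed
  qed (simp_all add: rules)
qed

lemma column_B_injective:
  assumes N_inj: "injective_module TYPE('w) A N"
    and N_endo: "\<And>\<theta>. \<theta> \<in> module_hom A N N \<Longrightarrow>
      \<exists>!b. b \<in> carrier B \<and> (\<forall>n\<in>carrier N. \<theta> n = n \<triangleleft>\<^bsub>N\<^esub> b)"
  shows "injective_module TYPE('w) \<Lambda> (column \<Lambda> e\<^sub>B)"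
proof -
  let ?h = "\<lambda>a. (a, \<zero>\<^bsub>N\<^esub>, \<zero>\<^bsub>M\<^esub>, \<zero>\<^bsub>B\<^esub>)"
  let ?\<delta> = "\<lambda>n. (\<zero>\<^bsub>A\<^esub>, n, \<zero>\<^bsub>M\<^esub>, \<zero>\<^bsub>B\<^esub>)"
  note rules = morita_ring_simps entry_rules
  interpret corner_map \<Lambda> A ?h
    by unfold_locales (auto simp: rules)
  show ?thesis
  proof (rule column_injective[OF _ _ _ _ _ N_inj, of e\<^sub>B ?\<delta>])
    show "\<exists>a\<in>carrier A. ?h a = ?h \<one>\<^bsub>A\<^esub> \<otimes>\<^bsub>\<Lambda>\<^esub> r \<otimes>\<^bsub>\<Lambda>\<^esub> ?h \<one>\<^bsub>A\<^esub>" if "r \<in> carrier \<Lambda>" for r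
      using that by (auto simp: rules)
    have "?\<delta> \<in> module_hom A N (corner (column \<Lambda> e\<^sub>B))"
      by (rule module_homI) (auto simp: rules)
    moreover have "bij_betw ?\<delta> (carrier N) (carrier (corner (column \<Lambda> e\<^sub>B)))"
      by (rule bij_betwI') (auto simp: rules)
    ultimately show "?\<delta> \<in> module_iso A N (corner (column \<Lambda> e\<^sub>B))"
      by (simp add: module_iso_def)
    fix \<theta> assume \<theta>: "\<theta> \<in> module_hom A N N"
    from N_endo[OF \<theta>] obtain b where b: "b \<in> carrier B \<and> (\<forall>n\<in>carrier N. \<theta> n = n \<triangleleft>\<^bsub>N\<^esub> b)"
      and uniq: "\<forall>b'. b' \<in> carrier B \<and> (\<forall>n\<in>carrier N. \<theta> n = n \<triangleleft>\<^bsub>N\<^esub> b') \<longrightarrow> b' = b"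
      by (rule ex1E) (rule that)
    show "\<exists>!x. x \<in> carrier \<Lambda> \<and> e\<^sub>B \<otimes>\<^bsub>\<Lambda>\<^esub> x = x \<and> x \<otimes>\<^bsub>\<Lambda>\<^esub> e\<^sub>B = x \<and>
        (\<forall>n\<in>carrier N. ?\<delta> (\<theta> n) = ?\<delta> n \<otimes>\<^bsub>\<Lambda>\<^esub> x)"
    proof (rule ex1I[of _ "(\<zero>\<^bsub>A\<^esub>, \<zero>\<^bsub>N\<^esub>, \<zero>\<^bsub>M\<^esub>, b)"])
      show "(\<zero>\<^bsub>A\<^esub>, \<zero>\<^bsub>N\<^esub>, \<zero>\<^bsub>M\<^esub>, b) \<in> carrier \<Lambda> \<and> e\<^sub>B \<otimes>\<^bsub>\<Lambda>\<^esub> (\<zero>\<^bsub>A\<^esub>, \<zero>\<^bsub>N\<^esub>, \<zero>\<^bsub>M\<^esub>, b) = (\<zero>\<^bsub>A\<^esub>, \<zero>\<^bsub>N\<^esub>, \<zero>\<^bsub>M\<^esub>, b) \<and>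
          (\<zero>\<^bsub>A\<^esub>, \<zero>\<^bsub>N\<^esub>, \<zero>\<^bsub>M\<^esub>, b) \<otimes>\<^bsub>\<Lambda>\<^esub> e\<^sub>B = (\<zero>\<^bsub>A\<^esub>, \<zero>\<^bsub>N\<^esub>, \<zero>\<^bsub>M\<^esub>, b) \<and>
          (\<forall>n\<in>carrier N. ?\<delta> (\<theta> n) = ?\<delta> n \<otimes>\<^bsub>\<Lambda>\<^esub> (\<zero>\<^bsub>A\<^esub>, \<zero>\<^bsub>N\<^esub>, \<zero>\<^bsub>M\<^esub>, b))"
        using b by (simp add: rules)
      fix x assume x: "x \<in> carrier \<Lambda> \<and> e\<^sub>B \<otimes>\<^bsub>\<Lambda>\<^esub> x = x \<and> x \<otimes>\<^bsub>\<Lambda>\<^esub> e\<^sub>B = x \<and>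
        (\<forall>n\<in>carrier N. ?\<delta> (\<theta> n) = ?\<delta> n \<otimes>\<^bsub>\<Lambda>\<^esub> x)"
      obtain a n m b' where "x = (a, n, m, b')"
        by (metis surj_pair)
      with x show "x = (\<zero>\<^bsub>A\<^esub>, \<zero>\<^bsub>N\<^esub>, \<zero>\<^bsub>M\<^esub>, b)"
        using uniq[rule_format, of b'] by (auto simp: rules)
    qed
  qed (simp_all add: rules)
qed

lemma regular_injective:
  assumes "injective_module TYPE('w) \<Lambda> (column \<Lambda> e\<^sub>A)" "injective_module TYPE('w) \<Lambda> (column \<Lambda> e\<^sub>B)"
  shows "injective_module TYPE('w) \<Lambda> (regular \<Lambda>)"
  by (rule \<Lambda>.regular_injective_from_columns[OF _ _ _ _ _ assms])
     (simp_all add: morita_ring_simps entry_rules)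

end

theorem proposition3p7:
  fixes A :: "'a ring" and B :: "'b ring"
    and N :: "('a, 'b, 'n) bimodule" and M :: "('b, 'a, 'm) bimodule"
    and \<phi> :: "('m \<times> 'n \<Rightarrow>\<^sub>0 int) set \<Rightarrow> 'b" and \<psi> :: "('n \<times> 'm \<Rightarrow>\<^sub>0 int) set \<Rightarrow> 'a"
    and K :: "'k ring" and h :: "'k \<Rightarrow> 'a \<times> 'n \<times> 'm \<times> 'b"
  assumes universe_large: "\<exists>\<iota> :: (nat \<Rightarrow> 'a \<times> 'n \<times> 'm \<times> 'b) set \<Rightarrow> 'u. inj \<iota>"
    and morita: "morita_data A B N M \<phi> \<psi>"
    and artin: "artin_algebra K h (morita_ring A B N M \<phi> \<psi>)"
    and equiv_M: "adjoint_pair_induces_equivalence TYPE('u) A B M"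
    and equiv_N: "adjoint_pair_induces_equivalence TYPE('u) B A N"
  shows "selfinjective TYPE('w) (morita_ring A B N M \<phi> \<psi>)"
proof -
  interpret artin_algebra K h "morita_ring A B N M \<phi> \<psi>" by (rule artin)
  interpret morita_ring_is_ring A B N M \<phi> \<psi>
    using morita R.ring_axioms by (simp add: morita_ring_is_ring_def)
  obtain \<iota> :: "(nat \<Rightarrow> 'a \<times> 'n \<times> 'm \<times> 'b) set \<Rightarrow> 'u" where \<iota>: "inj \<iota>"
    using universe_large by blast
  \<comment> \<open>Ring elements enter the universe as singletons of constant sequences.\<close>
  define \<epsilon>A :: "'a \<Rightarrow> 'u" where "\<epsilon>A a = \<iota> {\<lambda>_. (a, undefined, undefined, undefined)}" for a
  define \<epsilon>B :: "'b \<Rightarrow> 'u" where "\<epsilon>B b = \<iota> {\<lambda>_. (undefined, undefined, undefined, b)}" for b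
  have \<epsilon>: "inj \<epsilon>A" "inj \<epsilon>B"
    by (auto intro!: injI simp: \<epsilon>A_def \<epsilon>B_def inj_eq[OF \<iota>] fun_eq_iff)
  note from_M = equivalence_imp_injective_and_endomorphisms[OF M.bimodule_axioms equiv_M \<epsilon>]
  note from_N = equivalence_imp_injective_and_endomorphisms[OF N.bimodule_axioms equiv_N \<epsilon>(2,1)]
  show ?thesis
    unfolding selfinjective_def
    by (intro regular_injective column_A_injective column_B_injective from_M from_N)
qed

end
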